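(* There exists a non-differentiable orientation preserving minimal homeomorphism $f$ of the circle $\mathbb{T}=\mathbb{R}/\mathbb{Z}$ such that $f+f^{-1}$ is of class $C^1$.
   Context: Non-differentiable means not differentiable at some point of $\mathbb{T}$. A homeomorphism is minimal if all its orbits are dense. The sum $f+f^{-1}$ is taken in the group $\mathbb{R}/\mathbb{Z}$; it is of class $C^1$ if and only if, for a lift $\tilde f:\mathbb{R}\to\mathbb{R}$ of $f$, the function $\tilde f+\tilde f^{-1}:\mathbb{R}\to\mathbb{R}$ is of class $C^1$. *)

theory Defs
  imports "HOL-Analysis.Analysis"
begin

definition circle_rel :: "real \<Rightarrow> real \<Rightarrow> bool" where
  "circle_rel x y \<longleftrightarrow> x - y \<in> \<int>"

lemma equivp_circle_rel: "equivp circle_rel"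
proof (rule equivpI)
  show "reflp circle_rel"
    by (simp add: reflp_def circle_rel_def)
  show "symp circle_rel"
    by (auto simp: symp_def circle_rel_def dest: Ints_minus)
  show "transp circle_rel"
    by (auto simp: transp_def circle_rel_def dest: Ints_add)
qed

quotient_type circle = real / circle_rel
  by (rule equivp_circle_rel)

lift_definition circle_proj :: "real \<Rightarrow> circle" is "\<lambda>x. x" .

lemma circle_proj_eq_iff: "circle_proj x = circle_proj y \<longleftrightarrow> x - y \<in> \<int>"
  by transfer (simp add: circle_rel_def)

lemma surj_circle_proj: "surj circle_proj"
proof -
  have "\<exists>t. p = circle_proj t" for p
    by transfer (meson equivp_circle_rel equivp_reflp)
  then show ?thesis
    by (auto simp: surj_def)
qed

instantiation circle :: ab_group_add
begin

lift_definition zero_circle :: circle is 0 .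

lift_definition plus_circle :: "circle \<Rightarrow> circle \<Rightarrow> circle" is "(+)"
  by (auto simp: circle_rel_def add_diff_add)

lift_definition uminus_circle :: "circle \<Rightarrow> circle" is uminus
  by (auto simp: circle_rel_def dest: Ints_minus)

lift_definition minus_circle :: "circle \<Rightarrow> circle \<Rightarrow> circle" is "(-)"
proof -
  fix x x' y y' :: real
  assume "circle_rel x x'" "circle_rel y y'"
  then have "(x - x') - (y - y') \<in> \<int>"
    unfolding circle_rel_def by (rule Ints_diff)
  then show "circle_rel (x - y) (x' - y')"
    by (simp add: circle_rel_def algebra_simps)
qed

instance
proof
  fix a b c :: circle
  show "a + b + c = a + (b + c)"
    by transfer (simp add: circle_rel_def)
  show "a + b = b + a"
    by transfer (simp add: circle_rel_def)
  show "0 + a = a"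
    by transfer (simp add: circle_rel_def)
  show "- a + a = 0"
    by transfer (simp add: circle_rel_def)
  show "a - b = a + - b"
    by transfer (simp add: circle_rel_def)
qed

end

lemma circle_proj_add: "circle_proj (x + y) = circle_proj x + circle_proj y"
  by transfer (simp add: circle_rel_def)

text \<open>The circle carries the quotient topology.\<close>

instantiation circle :: topological_space
begin

definition open_circle :: "circle set \<Rightarrow> bool" where
  "open_circle U \<longleftrightarrow> open (circle_proj -` U)"

instance
proof
  show "open (UNIV :: circle set)"
    by (simp add: open_circle_def)
  show "open (S \<inter> T)" if "open S" "open T" for S T :: "circle set"
    using that by (simp add: open_circle_def open_Int)
  show "open (\<Union>K)" if "\<forall>S\<in>K. open S" for K :: "circle set set"
    using that by (simp add: open_circle_def vimage_Union open_UN)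
qed

end

definition circle_lift :: "(real \<Rightarrow> real) \<Rightarrow> (circle \<Rightarrow> circle) \<Rightarrow> bool" where
  "circle_lift F f \<longleftrightarrow>
     continuous_on UNIV F \<and> (\<forall>t. circle_proj (F t) = f (circle_proj t))"

definition orientation_preserving :: "(circle \<Rightarrow> circle) \<Rightarrow> bool" where
  "orientation_preserving f \<longleftrightarrow> (\<exists>F. circle_lift F f \<and> strict_mono F)"

text \<open>
  Differentiability at a point is tested on a local lift near a representative of that point;
  local lifts that are continuous at the representative differ by an integer constant nearby,
  and representatives by integer translations, so the choices do not matter.
\<close>

definition circle_differentiable_at :: "(circle \<Rightarrow> circle) \<Rightarrow> circle \<Rightarrow> bool" where
  "circle_differentiable_at f p \<longleftrightarrow>
     (\<exists>t F. circle_proj t = p \<and>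
        (\<forall>\<^sub>F s in nhds t. circle_proj (F s) = f (circle_proj s)) \<and>
        (F :: real \<Rightarrow> real) differentiable (at t))"

text \<open>
  Every continuous self-map of the circle has a lift, unique up to an integer constant, so
  being of class C1 is a property of any one lift.
\<close>

definition circle_C1 :: "(circle \<Rightarrow> circle) \<Rightarrow> bool" where
  "circle_C1 f \<longleftrightarrow> (\<exists>F. circle_lift F f \<and> F C1_differentiable_on UNIV)"

text \<open>Orbits are two-sided; the definition is meant for bijections.\<close>

definition full_orbit :: "('a \<Rightarrow> 'a) \<Rightarrow> 'a \<Rightarrow> 'a set" where
  "full_orbit f x = range (\<lambda>n. (f ^^ n) x) \<union> range (\<lambda>n. (inv f ^^ n) x)"

definition minimal :: "('a::topological_space \<Rightarrow> 'a) \<Rightarrow> bool" where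
  "minimal f \<longleftrightarrow> (\<forall>x. closure (full_orbit f x) = UNIV)"

end

theory Submission
  imports Defs
begin

text \<open>
  The map is sought in the form \<open>f = G \<circ> R \<circ> G\<inverse>\<close>, where \<open>R\<close> is the rotation by an irrational
  angle \<open>\<alpha>\<close> and \<open>G\<close> is an increasing homeomorphism of the line commuting with the translation
  by \<open>1\<close>; minimality is then inherited from \<open>R\<close>. If \<open>G\<close> is a primitive of a positive periodic
  function \<open>v\<close>, then \<open>\<phi> = f + f\<inverse>\<close> satisfies \<open>\<phi> (G x) = G (x + \<alpha>) + G (x - \<alpha>)\<close>, so that
  formally

    \<open>\<phi>' (G x) = c x\<close>  with  \<open>c x = (v (x + \<alpha>) + v (x - \<alpha>)) / v x\<close>,

  while \<open>f' (G x) = v (x + \<alpha>) / v x\<close>. Hence \<open>\<phi>\<close> may well be of class \<open>C\<^sup>1\<close> for a wild \<open>v\<close>: only \<open>c\<close>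
  has to be continuous.

  Along an orbit of \<open>R\<close> the definition of \<open>c\<close> is the discrete Schroedinger equation
  \<open>v (n + 1) + v (n - 1) = c n * v n\<close>, and \<open>v\<close> may be replaced by another positive solution of the
  same equation. By reduction of order these are, up to constants, \<open>v n * (1 + W * T n)\<close>, where
  \<open>T\<close> sums the numbers \<open>1 / (v j * v (j + 1))\<close>; the factor stays positive for a whole range of \<open>W\<close> if
  \<open>T\<close> is bounded, that is, if \<open>v\<close> grows fast enough in both directions of the orbit. Growth in turn is cheap: a factor that varies slowly along the
  orbit changes \<open>c\<close> only by a factor close to \<open>1\<close>.

  The function \<open>v\<close> is approached by continuous periodic functions \<open>v\<^sub>N\<close>. Stage \<open>N\<close> modifies the
  preceding function in a thin neighbourhood of a finite piece of the orbit of \<open>0\<close>: it lets the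
  values grow further and switches \<open>W\<close> from \<open>0\<close> to \<open>1\<close> or back. This changes \<open>c\<close> by a factor within
  \<open>exp (\<plusminus> 1 / 2 ^ N)\<close>, but it makes \<open>v\<^sub>N \<alpha> / v\<^sub>N 0\<close> oscillate between \<open>\<rho>\<close> and values at
  least \<open>\<rho> + 2 / 3\<close>. The neighbourhood is so thin that the primitives move much less than the
  length \<open>s\<^sub>N\<close> at which the previous slopes at \<open>0\<close> and \<open>\<alpha>\<close> are visible. In the limit \<open>c\<close> converges
  uniformly, whereas the difference quotients of \<open>f\<close> at \<open>G 0\<close> with increments \<open>G s\<^sub>N - G 0\<close> oscillate.

  The step along the orbit is \<open>room_transition\<close>, its realisation on the circle is
  \<open>perturb_along_orbit\<close>, the passage to the limit is \<open>limit_of_stages\<close>, and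
  \<open>stieltjes_chain_derivative\<close> makes the formula for \<open>\<phi>'\<close> rigorous although \<open>G\<close> need not be
  differentiable.
\<close>

section \<open>Circle maps and their lifts\<close>

lemma circle_proj_add_of_int: "circle_proj (x + of_int k) = circle_proj x"
  by (simp add: circle_proj_eq_iff)

lemma quasi_periodic_add_of_int:
  fixes F :: "real \<Rightarrow> real"
  assumes "\<And>x. F (x + 1) = F x + c"
  shows "F (x + of_int k) = F x + of_int k * c"
proof (induction k rule: int_induct[of _ 0])
  case (step1 i)
  have "F (x + of_int i + 1) = F (x + of_int i) + c" by (rule assms)
  with step1 show ?case by (simp add: algebra_simps)
next
  case (step2 i)
  have "F (x + of_int (i - 1) + 1) = F (x + of_int (i - 1)) + c" by (rule assms)
  with step2 show ?case by (simp add: algebra_simps)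
qed simp

lemma degree_one_add_of_int:
  fixes F :: "real \<Rightarrow> real"
  assumes "\<And>x. F (x + 1) = F x + 1"
  shows "F (x + of_int k) = F x + of_int k"
  using quasi_periodic_add_of_int[of F 1, OF assms] by simp

lemma degree_one_descends:
  assumes "continuous_on UNIV F" and F1: "\<And>x. F (x + 1) = F x + 1"
  obtains f where "circle_lift F f"
proof
  define f where "f p = circle_proj (F (SOME t. circle_proj t = p))" for p
  have "circle_proj (F t) = f (circle_proj t)" for t
  proof -
    define s where "s = (SOME s. circle_proj s = circle_proj t)"
    have "circle_proj s = circle_proj t"
      unfolding s_def by (rule someI) simp
    then obtain k where "s = t + of_int k"
      by (auto simp: circle_proj_eq_iff elim!: Ints_cases simp: algebra_simps)
    then show ?thesis
      by (simp add: f_def degree_one_add_of_int[of F, OF F1] circle_proj_add_of_int flip: s_def)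
  qed
  with assms(1) show "circle_lift F f"
    by (simp add: circle_lift_def)
qed

lemma circle_lift_continuous:
  assumes "circle_lift F f"
  shows "continuous_on UNIV f"
proof (subst continuous_on_open_vimage, simp, intro allI impI)
  fix U :: "circle set" assume "open U"
  then have "open (F -` (circle_proj -` U))"
    using assms unfolding circle_lift_def open_circle_def
    by (metis open_vimage)
  moreover have "F -` (circle_proj -` U) = circle_proj -` (f -` U)"
    using assms by (auto simp: circle_lift_def)
  ultimately show "open (f -` U \<inter> UNIV)"
    by (simp add: open_circle_def)
qed

lemma circle_lift_comp:
  assumes "circle_lift F f" "circle_lift G g"
  shows "circle_lift (F \<circ> G) (f \<circ> g)"
  using assms unfolding circle_lift_def
  by (auto intro: continuous_on_compose2)

lemma circle_lift_id_unique:
  assumes "circle_lift F f" "\<And>t. F t = t"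
  shows "f = id"
proof
  fix p
  obtain t where "p = circle_proj t" using surj_circle_proj by blast
  with assms show "f p = id p" by (metis circle_lift_def id_apply)
qed

lemma irrational_rotation_dense:
  fixes \<alpha> x y e :: real
  assumes "\<alpha> \<notin> \<rat>" "0 < e"
  obtains n :: nat and k :: int where "\<bar>x + of_nat n * \<alpha> + of_int k - y\<bar> < e"
proof -
  obtain h k where "k > 0" "\<bar>of_int k * \<alpha> - of_int h - (y - x)\<bar> < e"
    using sequence_of_fractional_parts_is_dense[OF assms] by metis
  then show ?thesis
    by (intro that[of "nat k" "- h"]) (simp add: algebra_simps)
qed

text \<open>
  Already the forward orbit is dense: through the semiconjugacy it is the image of an orbit of the
  irrational rotation.
\<close>

lemma rotation_conjugate_minimal:
  fixes G :: "real \<Rightarrow> real"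
  assumes \<alpha>: "\<alpha> \<notin> \<rat>" and G: "continuous_on UNIV G" "surj G" and G1: "\<And>x. G (x + 1) = G x + 1"
    and f: "\<And>x. f (circle_proj (G x)) = circle_proj (G (x + \<alpha>))"
  shows "minimal f"
  unfolding minimal_def
proof (rule allI, rule ccontr)
  fix p assume ne: "closure (full_orbit f p) \<noteq> UNIV"
  define U where "U = - closure (full_orbit f p)"
  define V where "V = G -` (circle_proj -` U)"
  have "open U" "U \<noteq> {}" using ne by (auto simp: U_def)
  then have "open V"
    unfolding V_def open_circle_def using G(1)
    by (metis open_vimage)
  obtain q where "q \<in> U" using \<open>U \<noteq> {}\<close> by blast
  obtain y where "y \<in> V"
    using \<open>q \<in> U\<close> surj_circle_proj G(2) unfolding V_def surj_def by (metis vimageI)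
  with \<open>open V\<close> obtain e where e: "0 < e" "ball y e \<subseteq> V"
    by (meson open_contains_ball)
  obtain x where x: "p = circle_proj (G x)"
    using surj_circle_proj G(2) unfolding surj_def by metis
  have orbit: "(f ^^ n) p = circle_proj (G (x + of_nat n * \<alpha>))" for n
    by (induction n) (simp_all add: x f algebra_simps)
  obtain n k where nk: "\<bar>x + of_nat n * \<alpha> + of_int k - y\<bar> < e"
    using irrational_rotation_dense[OF \<alpha> e(1)] by blast
  then have "x + of_nat n * \<alpha> + of_int k \<in> V"
    using e(2) by (auto simp: dist_real_def)
  then have "(f ^^ n) p \<in> U"
    by (simp add: V_def orbit degree_one_add_of_int[of G, OF G1] circle_proj_add_of_int)
  moreover have "(f ^^ n) p \<in> closure (full_orbit f p)"
    using closure_subset by (fastforce simp: full_orbit_def)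
  ultimately show False by (simp add: U_def)
qed

text \<open>
  The difference of a local lift and the global lift is integer-valued and continuous at the base
  point, hence constant near it, and the choice of representative only adds an integer translation.
\<close>

lemma circle_differentiable_at_lift:
  assumes F: "circle_lift F f" and F1: "\<And>x. F (x + 1) = F x + 1"
    and "circle_differentiable_at f (circle_proj t)"
  shows "F differentiable (at t)"
proof -
  obtain s H where s: "circle_proj s = circle_proj t"
    and ev: "\<forall>\<^sub>F u in nhds s. circle_proj (H u) = f (circle_proj u)"
    and H: "(H :: real \<Rightarrow> real) differentiable (at s)"
    using assms(3) unfolding circle_differentiable_at_def by blast
  have cont: "isCont (\<lambda>u. H u - F u) s"
    using differentiable_imp_continuous_within[OF H] F
    by (auto simp: circle_lift_def continuous_on_eq_continuous_at intro!: continuous_diff)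
  have int: "\<forall>\<^sub>F u in nhds s. H u - F u \<in> \<int>"
    using ev by eventually_elim
      (use F in \<open>metis circle_lift_def circle_proj_eq_iff\<close>)
  have ints: "H s - F s \<in> \<int>"
    using int by (rule eventually_nhds_x_imp_x)
  have "\<forall>\<^sub>F u in nhds s. \<bar>(H u - F u) - (H s - F s)\<bar> < 1"
    using tendstoD[OF iffD1[OF tendsto_at_iff_tendsto_nhds cont[unfolded isCont_def]], of 1]
    by (simp add: dist_real_def)
  with int have "\<forall>\<^sub>F u in nhds s. F u = H u - (H s - F s)"
  proof eventually_elim
    case (elim u)
    then have "(H u - F u) - (H s - F s) = 0"
      using ints by (metis Ints_diff Ints_nonzero_abs_less1)
    then show ?case by simp
  qed
  moreover obtain D where D: "(H has_real_derivative D) (at s)"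
    using H by (auto simp: real_differentiable_def)
  ultimately have "(F has_real_derivative D) (at s)"
    using DERIV_cong_ev[OF refl _ refl, of F "\<lambda>u. H u - (H s - F s)" s D]
      DERIV_diff[OF D DERIV_const[of "H s - F s"]] by simp
  moreover obtain k where k: "t = s + of_int k"
    using s by (metis Ints_cases add.commute circle_proj_eq_iff diff_add_cancel)
  ultimately have "((\<lambda>u. F (u + of_int k)) has_real_derivative D) (at s)"
    using DERIV_add[OF _ DERIV_const, of F D s UNIV "of_int k"]
    by (simp add: degree_one_add_of_int[of F, OF F1])
  then have "(F has_real_derivative D) (at t)"
    by (simp add: k DERIV_shift)
  then show ?thesis
    by (auto simp: real_differentiable_def)
qed

section \<open>Second order equations along an orbit\<close>

text \<open>
  For a solution \<open>r\<close> of a second order equation, \<open>r n * recip_sum r L n\<close> is a second solution on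
  \<open>\<bar>n\<bar> < L\<close>. The sum starts at \<open>-L\<close> rather than at \<open>0\<close> to be nonnegative, and it is frozen outside
  \<open>{-L..L}\<close>, so that it is a constant factor there.
\<close>

definition recip_sum :: "(int \<Rightarrow> real) \<Rightarrow> int \<Rightarrow> int \<Rightarrow> real" where
  "recip_sum r L n = (\<Sum>j\<in>{-L..<min n L}. 1 / (r j * r (j + 1)))"

lemma recip_sum_step:
  "recip_sum r L (n + 1) =
     recip_sum r L n + (if -L \<le> n \<and> n < L then 1 / (r n * r (n + 1)) else 0)"
proof (cases "-L \<le> n \<and> n < L")
  case True
  then have "{-L..<min (n + 1) L} = insert n {-L..<min n L}"
    by auto
  with True show ?thesis
    unfolding recip_sum_def by simp
next
  case False
  then have "{-L..<min (n + 1) L} = {-L..<min n L}"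
    by auto
  with False show ?thesis
    unfolding recip_sum_def by auto
qed

lemma recip_sum_bounds:
  assumes "\<And>n. \<bar>n\<bar> \<le> L \<Longrightarrow> 0 < r n"
  shows "0 \<le> recip_sum r L n" and "recip_sum r L n \<le> recip_sum r L L"
proof -
  have pos: "0 \<le> 1 / (r j * r (j + 1))" if "j \<in> {-L..<L}" for j
    using that assms[of j] assms[of "j + 1"] by (auto simp: less_imp_le)
  show "0 \<le> recip_sum r L n"
    unfolding recip_sum_def by (intro sum_nonneg pos) auto
  show "recip_sum r L n \<le> recip_sum r L L"
    unfolding recip_sum_def by (rule sum_mono2) (use pos in auto)
qed

lemma recip_sum_cong:
  assumes "\<And>n. \<bar>n\<bar> \<le> L \<Longrightarrow> r n = r' n"
  shows "recip_sum r L n = recip_sum r' L n"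
  unfolding recip_sum_def by (rule sum.cong) (auto simp: assms)

text \<open>
  The increments of \<open>m\<close> say that \<open>r\<close> and \<open>r m\<close> have constant Wronskian \<open>W\<close>, so the two sequences solve
  the same second order equation.
\<close>

lemma reduction_of_order:
  fixes r m :: "int \<Rightarrow> real"
  assumes "r n \<noteq> 0"
    and "r n * r (n + 1) * (m (n + 1) - m n) = W"
    and "r (n - 1) * r n * (m n - m (n - 1)) = W"
  shows "r (n + 1) * m (n + 1) + r (n - 1) * m (n - 1) = (r (n + 1) + r (n - 1)) * m n"
proof -
  have "r n * (r (n + 1) * (m (n + 1) - m n)) = r n * (r (n - 1) * (m n - m (n - 1)))"
    using assms(2,3) by (simp add: algebra_simps)
  with assms(1) have "r (n + 1) * (m (n + 1) - m n) = r (n - 1) * (m n - m (n - 1))"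
    by simp
  then show ?thesis
    by (simp add: algebra_simps)
qed

text \<open>
  Parameters of stage \<open>N\<close>: \<open>rate\<close> bounds the logarithmic change of \<open>c\<close>; \<open>wall\<close> is the height that the
  values have reached at the ends of the current window; \<open>run\<close> is the number of steps, prepared one
  stage in advance, in which the next growth takes place; \<open>budget\<close> bounds the reciprocal sums, always
  below \<open>1 / 2\<close>; and \<open>tilt\<close> is the Wronskian \<open>W\<close> that alternates between the stages. They are tied
  together by \<open>wall_growth\<close> (a run at the admissible rate suffices to reach the next wall) and
  \<open>budget_step\<close> (the reciprocals met during a run fit into the budget).
\<close>

definition rate :: "nat \<Rightarrow> real" where "rate N = 1 / 2 ^ N"
definition wall :: "nat \<Rightarrow> real" where "wall N = 4 ^ (N + 4)"
definition run :: "nat \<Rightarrow> int" where "run N = 4 ^ (N + 2)"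
definition budget :: "nat \<Rightarrow> real" where "budget N = 1 / 2 - 1 / (4 * 4 ^ N)"
definition tilt :: "nat \<Rightarrow> real" where "tilt N = (if even N then 0 else 1)"

text \<open>
  The values \<open>v n\<close> are those on the orbit of \<open>0\<close>. They are the tilted form of a reference solution \<open>r\<close>
  that has climbed to the wall at both ends of the window \<open>{-L..L}\<close> and stays above it for another
  run. Bounded reciprocal sums leave room for changing the tilt, and the high walls make it cheap to
  stop tilting at \<open>\<plusminus> L\<close>. Only a finite part of \<open>v\<close> is constrained, because thin bumps on the circle
  control only finitely many points of the orbit.
\<close>

definition roomy :: "real \<Rightarrow> nat \<Rightarrow> (int \<Rightarrow> real) \<Rightarrow> bool" where
  "roomy \<rho> N v \<longleftrightarrow> (\<exists>r L. 1 \<le> L \<and> r 0 = 1 \<and> r 1 = \<rho> \<and>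
     (\<forall>n. \<bar>n\<bar> \<le> L + run (N + 1) \<longrightarrow> v n = r n * (1 + tilt N * recip_sum r L n)) \<and>
     (\<forall>n. \<bar>n\<bar> \<le> L \<longrightarrow> 1 \<le> r n) \<and>
     (\<forall>n. L \<le> \<bar>n\<bar> \<and> \<bar>n\<bar> \<le> L + run (N + 1) \<longrightarrow> wall N \<le> r n) \<and>
     recip_sum r L L \<le> budget N)"

text \<open>
  Equality of positive numbers up to a factor \<open>exp s\<close>, in a form without division.
\<close>

definition close_up :: "real \<Rightarrow> real \<Rightarrow> real \<Rightarrow> bool" where
  "close_up s x y \<longleftrightarrow> x \<le> exp s * y \<and> y \<le> exp s * x"

lemma close_upD: "close_up s x y \<Longrightarrow> x \<le> exp s * y" "close_up s x y \<Longrightarrow> y \<le> exp s * x"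
  by (auto simp: close_up_def)

lemma close_up_mult:
  assumes "close_up s x y" "close_up t x' y'" "0 \<le> x" "0 \<le> y" "0 \<le> x'" "0 \<le> y'"
  shows "close_up (s + t) (x * x') (y * y')"
  using mult_mono[of x "exp s * y" x' "exp t * y'"] mult_mono[of y "exp s * x" y' "exp t * x'"]
    assms unfolding close_up_def by (simp add: exp_add algebra_simps)

lemma close_up_inverse:
  assumes "close_up s x y" "0 < x" "0 < y"
  shows "close_up s (1 / x) (1 / y)"
  using assms unfolding close_up_def by (simp add: divide_simps mult.commute)

lemma close_up_max:
  assumes "close_up s x y" "0 \<le> s"
  shows "close_up s (max 1 x) (max 1 y)"
proof -
  have "max 1 a \<le> exp s * max 1 b" if "a \<le> exp s * b" for a b :: real
  proof (rule max.boundedI)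
    have "1 * 1 \<le> exp s * max 1 b"
      using assms(2) by (intro mult_mono) auto
    then show "1 \<le> exp s * max 1 b" by simp
    show "a \<le> exp s * max 1 b"
      by (rule order_trans[OF that]) (auto intro: mult_left_mono)
  qed
  then show ?thesis using assms(1) unfolding close_up_def by blast
qed

lemma close_up_exp: "\<bar>x - y\<bar> \<le> s \<Longrightarrow> close_up s (exp x) (exp y)"
  unfolding close_up_def by (auto simp flip: exp_add)

lemma close_up_affine:
  assumes "1 \<le> x" "0 \<le> d" "d \<le> s"
  shows "close_up s x (x + d)"
proof -
  have s: "1 + s \<le> exp s" "1 \<le> exp s" using assms by auto
  have "(1 + s) * x \<le> exp s * x" "x \<le> exp s * x" "s \<le> s * x" "x + d \<le> exp s * (x + d)"
    using s assms mult_left_mono[of 1 x s] mult_right_mono[of 1 "exp s" x] mult_right_mono[of 1 "exp s" "x + d"]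
    by (auto intro!: mult_right_mono mult_left_mono)
  then show ?thesis using assms unfolding close_up_def by (auto simp: algebra_simps)
qed

text \<open>
  The quotient of the two sides is \<open>c[v p] / c[v]\<close>, where \<open>c[v] n = (v (n + 1) + v (n - 1)) / v n\<close>.
  Since \<open>c[v p] n\<close> is the sum of \<open>v (n \<plusminus> 1) / v n\<close> weighted by \<open>p (n \<plusminus> 1) / p n\<close>, a slowly varying
  factor \<open>p\<close> changes \<open>c\<close> by a factor close to \<open>1\<close>, whatever \<open>v\<close> is.
\<close>

lemma slow_factor_close_up:
  fixes v p :: "int \<Rightarrow> real"
  assumes "close_up s (p n) (p (n + 1))" "close_up s (p (n - 1)) (p n)"
    and "0 < v (n - 1)" "0 < v n" "0 < v (n + 1)"
  shows "close_up s ((v (n + 1) * p (n + 1) + v (n - 1) * p (n - 1)) * v n)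
                    ((v (n + 1) + v (n - 1)) * (v n * p n))"
proof -
  have p: "p (n + 1) \<le> exp s * p n" "p n \<le> exp s * p (n + 1)"
       "p (n - 1) \<le> exp s * p n" "p n \<le> exp s * p (n - 1)"
    using assms by (auto simp: close_up_def)
  have "v (n + 1) * p (n + 1) + v (n - 1) * p (n - 1)
          \<le> v (n + 1) * (exp s * p n) + v (n - 1) * (exp s * p n)"
    using p assms by (intro add_mono mult_left_mono) auto
  from mult_right_mono[OF this, of "v n"] assms
  have 1: "(v (n + 1) * p (n + 1) + v (n - 1) * p (n - 1)) * v n
          \<le> exp s * ((v (n + 1) + v (n - 1)) * (v n * p n))"
    by (simp add: algebra_simps)
  have "v (n + 1) * p n + v (n - 1) * p n
          \<le> v (n + 1) * (exp s * p (n + 1)) + v (n - 1) * (exp s * p (n - 1))"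
    using p assms by (intro add_mono mult_left_mono) auto
  from mult_right_mono[OF this, of "v n"] assms
  have 2: "(v (n + 1) + v (n - 1)) * (v n * p n)
          \<le> exp s * ((v (n + 1) * p (n + 1) + v (n - 1) * p (n - 1)) * v n)"
    by (simp add: algebra_simps)
  from 1 2 show ?thesis by (simp add: close_up_def)
qed

lemma wall_growth: "3 * wall (Suc N) \<le> exp (rate (Suc N) * run (Suc N))"
proof -
  have "wall (Suc N) * 3 \<le> wall (Suc N) * 4"
    by (simp add: wall_def)
  also have "\<dots> = 4 ^ (N + 6)"
    by (simp add: wall_def power_add)
  also have "(4::real) ^ (N + 6) = 2 ^ (2 * N + 12)"
    by (simp add: power_mult power_add)
  also have "\<dots> \<le> 2 ^ (2 ^ (N + 5))"
  proof (rule power_increasing)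
    show "(2::nat) * N + 12 \<le> 2 ^ (N + 5)"
    proof (induction N)
      case (Suc N)
      have "(2::nat) ^ (Suc N + 5) = 2 ^ (N + 5) + 2 ^ (N + 5)"
        by (simp add: power_add)
      moreover have "(2::nat) ^ 5 \<le> 2 ^ (N + 5)" by (rule power_increasing) auto
      ultimately show ?case using Suc by simp
    qed simp
  qed simp
  also have "\<dots> \<le> (exp 1) ^ (2 ^ (N + 5))"
    using exp_ge_add_one_self[of 1] by (intro power_mono) auto
  also have "\<dots> = exp (2 ^ (N + 5))"
    by (simp flip: exp_of_nat_mult)
  also have "(2::real) ^ (N + 5) = rate (Suc N) * run (Suc N)"
  proof -
    have "(4::real) ^ N = 2 ^ N * 2 ^ N" 
      by (simp flip: power_mult_distrib)
    then show ?thesis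
      by (simp add: rate_def run_def power_add)
  qed
  finally show ?thesis by (simp add: mult.commute)
qed

lemma budget_step: "budget N + 2 * run (Suc N) / (wall N)\<^sup>2 \<le> budget (Suc N)"
  by (simp add: budget_def run_def wall_def power_add power2_eq_square field_simps)


text \<open>
  The new sequence \<open>u\<close> arises from \<open>v\<close> by three changes: the reference solution is multiplied by a
  factor \<open>a\<close> that equals \<open>1\<close> on the old window, then grows exponentially past the next wall, and
  finally decays; the old tilt \<open>m\<close> is replaced by the new tilt \<open>m'\<close> on the longer window; and far out
  the total factor is cut off at \<open>1\<close>, so that \<open>u\<close> returns to \<open>v\<close>. Inside the old window both \<open>u\<close> and
  \<open>v\<close> solve the equation of \<open>r\<close>, so \<open>c\<close> does not change there. Everywhere else the total factor varies
  slowly: the tilts do so because their increments are at most the reciprocal of the wall.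
\<close>

lemma room_transition:
  assumes room: "roomy \<rho> N v" and v: "\<And>n. 1 / 2 < v n"
  obtains u R where "1 \<le> R" "\<And>n. 1 / 2 < u n" "\<And>n. R \<le> \<bar>n\<bar> \<Longrightarrow> u n = v n"
    "\<And>n. close_up (3 / 4 * rate N) ((u (n + 1) + u (n - 1)) * v n) ((v (n + 1) + v (n - 1)) * u n)"
    "\<And>u'. (\<And>n. \<bar>n\<bar> \<le> R \<Longrightarrow> u' n = u n) \<Longrightarrow> roomy \<rho> (Suc N) u'"
proof -
  define K1 K2 where "K1 = run (Suc N)" and "K2 = run (Suc (Suc N))"
  have K: "1 \<le> K1" "1 \<le> K2"
    unfolding K1_def K2_def run_def by (rule one_le_power, simp)+
  obtain r L where L: "1 \<le> L" and r01: "r 0 = 1" "r 1 = \<rho>"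
    and vr: "\<And>n. \<bar>n\<bar> \<le> L + K1 \<Longrightarrow> v n = r n * (1 + tilt N * recip_sum r L n)"
    and r1: "\<And>n. \<bar>n\<bar> \<le> L \<Longrightarrow> 1 \<le> r n"
    and rw: "\<And>n. L \<le> \<bar>n\<bar> \<Longrightarrow> \<bar>n\<bar> \<le> L + K1 \<Longrightarrow> wall N \<le> r n"
    and bud: "recip_sum r L L \<le> budget N"
    using room unfolding roomy_def K1_def by auto
  have wall1: "1 \<le> wall M" for M
    unfolding wall_def by (rule one_le_power) simp
  define L' where "L' = L + K1"
  \<comment> \<open>The exponent of the growth factor: a tent over \<open>\<bar>n\<bar> \<ge> L\<close> with slopes \<open>\<plusminus> 1\<close>, at least \<open>K1\<close> on the
    whole stretch that the next stage will use.\<close>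
  define h where "h n = min (max 0 (\<bar>n\<bar> - L)) (L' + K2 + K1 - \<bar>n\<bar>)" for n :: int
  define a where "a n = exp (rate (Suc N) * h n)" for n
  define r' where "r' n = r n * a n" for n
  define m where "m n = 1 + tilt N * recip_sum r L n" for n
  define m' where "m' n = 1 + tilt (Suc N) * recip_sum r' L' n" for n
  define x where "x n = a n * m' n / m n" for n
  \<comment> \<open>Cutting off at \<open>1\<close> is postponed to \<open>\<bar>n\<bar> > L'\<close>, since inside the old window \<open>x\<close> may be below \<open>1\<close>;
    at \<open>\<bar>n\<bar> = L'\<close> both branches agree.\<close>
  define p where "p n = (if \<bar>n\<bar> \<le> L' then x n else max 1 (x n))" for n
  define u where "u n = v n * p n" for n
  \<comment> \<open>Beyond the new window the reference solution is whatever produces \<open>u\<close>.\<close>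
  define r'' where "r'' n = (if \<bar>n\<bar> \<le> L' then r' n else u n / m' n)" for n
  define \<sigma> where "\<sigma> = rate (Suc N) + (1 / wall N + 1 / wall N)"
  have rate0: "0 < rate M" for M by (simp add: rate_def)
  have tilt01: "0 \<le> tilt M" "tilt M \<le> 1" for M by (simp_all add: tilt_def)
  have budget_half: "budget M \<le> 1 / 2" for M by (simp add: budget_def)
  have r1': "1 \<le> r n" if "\<bar>n\<bar> \<le> L'" for n
    using that r1[of n] rw[of n] wall1[of N] by (cases "\<bar>n\<bar> \<le> L") (auto simp: L'_def)
  have a1: "1 \<le> a n" if "\<bar>n\<bar> \<le> L'" for n
    using that K rate0[of "Suc N"] by (auto simp: a_def h_def)
  have aL: "a n = 1" if "\<bar>n\<bar> \<le> L" for n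
    using that K L by (auto simp: a_def h_def L'_def)
  have a_big: "3 * wall (Suc N) \<le> a n" if "L' \<le> \<bar>n\<bar>" "\<bar>n\<bar> \<le> L' + K2" for n
  proof -
    have "K1 \<le> h n" using that K L by (auto simp: h_def L'_def)
    then have "exp (rate (Suc N) * K1) \<le> a n"
      using rate0[of "Suc N"] by (auto simp: a_def)
    with wall_growth[of N] show ?thesis by (simp add: K1_def)
  qed
  have r'_ge: "r n \<le> r' n" if "\<bar>n\<bar> \<le> L'" for n
    using mult_left_mono[OF a1[OF that], of "r n"] r1'[OF that] by (simp add: r'_def)
  have r'1: "1 \<le> r' n" if "\<bar>n\<bar> \<le> L'" for n
    using r'_ge[OF that] r1'[OF that] by simp
  have bud': "recip_sum r' L' L' \<le> budget (Suc N)"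
  proof -
    have split: "{-L'..<L'} = {-L..<L} \<union> ({-L'..<-L} \<union> {L..<L'})"
      using K L by (auto simp: L'_def)
    have e: "1 / (r' j * r' (j + 1)) \<le> 1 / (wall N)\<^sup>2"
      if "j \<in> {-L'..<-L} \<union> {L..<L'}" for j
    proof -
      have w: "wall N \<le> r' j" "wall N \<le> r' (j + 1)"
        using that L rw[of j] rw[of "j + 1"] r'_ge[of j] r'_ge[of "j + 1"]
        by (auto simp: L'_def)
      have "wall N * wall N \<le> r' j * r' (j + 1)"
        using w wall1[of N] by (intro mult_mono) auto
      then show ?thesis
        using w wall1[of N]
        by (auto simp: power2_eq_square intro!: divide_left_mono mult_pos_pos)
    qed
    have "recip_sum r' L' L' = (\<Sum>j\<in>{-L..<L}. 1 / (r' j * r' (j + 1)))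
       + (\<Sum>j\<in>{-L'..<-L} \<union> {L..<L'}. 1 / (r' j * r' (j + 1)))"
      unfolding recip_sum_def min.idem split by (rule sum.union_disjoint) auto
    also have "(\<Sum>j\<in>{-L..<L}. 1 / (r' j * r' (j + 1))) = recip_sum r L L"
      unfolding recip_sum_def by (rule sum.cong) (auto simp: r'_def aL)
    also have "(\<Sum>j\<in>{-L'..<-L} \<union> {L..<L'}. 1 / (r' j * r' (j + 1)))
        \<le> of_nat (card ({-L'..<-L} \<union> {L..<L'})) * (1 / (wall N)\<^sup>2)"
      by (rule sum_bounded_above) (use e in auto)
    also have "card ({-L'..<-L} \<union> {L..<L'}) = nat (2 * K1)"
      using K L by (subst card_Un_disjoint) (auto simp: L'_def)
    finally show ?thesis
      using bud budget_step[of N] K by (simp add: K1_def)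
  qed
  have T: "0 \<le> recip_sum r L n" "recip_sum r L n \<le> 1 / 2"
       "0 \<le> recip_sum r' L' n" "recip_sum r' L' n \<le> 1 / 2" for n
    using recip_sum_bounds[of L r n] recip_sum_bounds[of L' r' n] r1 r'1 bud bud'
      budget_half[of N] budget_half[of "Suc N"] by force+
  have m: "1 \<le> m n" "m n \<le> 3 / 2" "1 \<le> m' n" "m' n \<le> 3 / 2" for n
    using T[of n] tilt01[of N] tilt01[of "Suc N"]
      mult_mono[of "tilt N" 1 "recip_sum r L n" "1/2"]
      mult_mono[of "tilt (Suc N)" 1 "recip_sum r' L' n" "1/2"]
    by (auto simp: m_def m'_def)
  have m_step: "m (n + 1) = m n + (if -L \<le> n \<and> n < L then tilt N / (r n * r (n + 1)) else 0)" for n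
    by (simp add: m_def recip_sum_step distrib_left)
  have m'_step: "m' (n + 1) = m' n + (if -L' \<le> n \<and> n < L' then tilt (Suc N) / (r' n * r' (n + 1)) else 0)" for n
    by (simp add: m'_def recip_sum_step distrib_left)
  have edge: "t / (y * z) \<le> 1 / wall N" if "0 \<le> t" "t \<le> 1" "1 \<le> y" "1 \<le> z" "wall N \<le> y \<or> wall N \<le> z"
    for t y z :: real
  proof -
    have "wall N \<le> y * z"
      using that mult_mono[of "wall N" y 1 z] mult_mono[of 1 y "wall N" z] wall1[of N] by auto
    with that wall1[of N] show ?thesis
      by (intro frac_le) auto
  qed
  have x_slow: "close_up \<sigma> (x n) (x (n + 1))" if n: "L \<le> \<bar>n\<bar> \<or> L \<le> \<bar>n + 1\<bar>" for n
  proof -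
    have "\<bar>h n - h (n + 1)\<bar> \<le> 1"
      unfolding h_def by linarith
    then have "\<bar>real_of_int (h n - h (n + 1))\<bar> \<le> 1"
      by linarith
    then have "\<bar>rate (Suc N) * h n - rate (Suc N) * h (n + 1)\<bar> \<le> rate (Suc N)"
      using rate0[of "Suc N"] by (simp add: abs_mult flip: right_diff_distrib)
    then have ca: "close_up (rate (Suc N)) (a n) (a (n + 1))"
      unfolding a_def by (rule close_up_exp)
    have cm: "close_up (1 / wall N) (m n) (m (n + 1))"
    proof (cases "-L \<le> n \<and> n < L")
      case True
      then have "tilt N / (r n * r (n + 1)) \<le> 1 / wall N"
        using n K L by (intro edge tilt01 r1 rw) (auto intro!: rw)
      moreover have "0 \<le> tilt N / (r n * r (n + 1))"
        using True r1[of n] r1[of "n + 1"] tilt01[of N]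
          by (intro divide_nonneg_nonneg mult_nonneg_nonneg) linarith+
      ultimately show ?thesis
        using True unfolding m_step by (auto intro!: close_up_affine m)
    next
      case False
      then show ?thesis
        using close_up_affine[of "m n" 0 "1 / wall N"] m(1)[of n] wall1[of N] unfolding m_step by auto
    qed
    have cm': "close_up (1 / wall N) (m' n) (m' (n + 1))"
    proof (cases "-L' \<le> n \<and> n < L'")
      case True
      have w: "wall N \<le> r' k" if "L \<le> \<bar>k\<bar>" "\<bar>k\<bar> \<le> L'" for k
        using rw[of k] r'_ge[of k] that by (auto simp: L'_def)
      from True have "tilt (Suc N) / (r' n * r' (n + 1)) \<le> 1 / wall N"
        using n K L by (intro edge tilt01 r'1) (auto intro!: w)
      moreover have "0 \<le> tilt (Suc N) / (r' n * r' (n + 1))"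
        using True r'1[of n] r'1[of "n + 1"] tilt01[of "Suc N"]
          by (intro divide_nonneg_nonneg mult_nonneg_nonneg) linarith+
      ultimately show ?thesis
        using True unfolding m'_step by (auto intro!: close_up_affine m)
    next
      case False
      then show ?thesis
        using close_up_affine[of "m' n" 0 "1 / wall N"] m(3)[of n] wall1[of N] unfolding m'_step by auto
    qed
    have pos: "0 < m k" "0 < m' k" "0 < a k" for k
      using m(1,3)[of k] by (auto simp: a_def)
    have "close_up \<sigma> (a n * (m' n * (1 / m n))) (a (n + 1) * (m' (n + 1) * (1 / m (n + 1))))"
      unfolding \<sigma>_def using pos[of n] pos[of "n + 1"]
      by (intro close_up_mult ca cm' close_up_inverse cm) (auto simp: less_imp_le)
    then show ?thesis
      by (simp add: x_def)
  qed
  have \<sigma>0: "0 \<le> \<sigma>"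
    using rate0[of "Suc N"] wall1[of N] by (simp add: \<sigma>_def)
  have x1: "1 \<le> x n" if "\<bar>n\<bar> = L'" for n
  proof -
    have "3 * 1 \<le> a n"
      using a_big[of n] that K wall1[of "Suc N"] by auto
    with m[of n] mult_mono[of 3 "a n" 1 "m' n"] show ?thesis
      by (auto simp: x_def)
  qed
  have p_slow: "close_up \<sigma> (p n) (p (n + 1))" if n: "L \<le> \<bar>n\<bar> \<or> L \<le> \<bar>n + 1\<bar>" for n
  proof (cases "\<bar>n\<bar> \<le> L' \<and> \<bar>n + 1\<bar> \<le> L'")
    case True
    then show ?thesis using x_slow[OF n] by (simp add: p_def)
  next
    case False
    then have "L' \<le> \<bar>n\<bar>" "L' \<le> \<bar>n + 1\<bar>"
      using K L by (auto simp: L'_def)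
    then have "p n = max 1 (x n)" "p (n + 1) = max 1 (x (n + 1))"
      using x1[of n] x1[of "n + 1"] by (auto simp: p_def max_def)
    then show ?thesis
      using close_up_max[OF x_slow[OF n] \<sigma>0] by simp
  qed
  have x0: "0 < x n" for n
    using m(1,3)[of n] by (simp add: x_def a_def)
  have vpos: "0 < v n" for n
    using v[of n] by simp
  have u_in: "u n = r' n * m' n" if "\<bar>n\<bar> \<le> L'" for n
    using that vr[of n] m(1)[of n] by (simp add: u_def p_def x_def r'_def L'_def flip: m_def)
  have u_half: "1 / 2 < u n" for n
  proof (cases "\<bar>n\<bar> \<le> L'")
    case True
    have "1 * 1 \<le> r' n * m' n"
      using r'1[OF True] m(3)[of n] by (intro mult_mono) auto
    with u_in[OF True] show ?thesis by simp
  next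
    case False
    then have "v n * 1 \<le> u n"
      using vpos[of n] unfolding u_def by (intro mult_left_mono) (auto simp: p_def)
    with v[of n] show ?thesis by simp
  qed
  have near: "close_up (3 / 4 * rate N) ((u (n + 1) + u (n - 1)) * v n) ((v (n + 1) + v (n - 1)) * u n)" for n
  proof (cases "\<bar>n\<bar> < L")
    case True
    have rpos: "0 < r k" if "\<bar>k\<bar> \<le> L" for k
      using r1[OF that] by simp
    have "\<bar>n - 1\<bar> \<le> L" "\<bar>n + 1\<bar> \<le> L" "\<bar>n\<bar> \<le> L"
      using True by linarith+
    then have rr: "r (n - 1) \<noteq> 0" "r n \<noteq> 0" "r (n + 1) \<noteq> 0"
      using rpos[of "n - 1"] rpos[of n] rpos[of "n + 1"] by force+
    have r'r: "r' k = r k" if "\<bar>k\<bar> \<le> L" for k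
      using that by (simp add: r'_def aL)
    have 1: "r (n + 1) * m (n + 1) + r (n - 1) * m (n - 1) = (r (n + 1) + r (n - 1)) * m n"
      by (rule reduction_of_order[where W = "tilt N"])
         (use True rr m_step[of n] m_step[of "n - 1"] in auto)
    have 2: "r (n + 1) * m' (n + 1) + r (n - 1) * m' (n - 1) = (r (n + 1) + r (n - 1)) * m' n"
      by (rule reduction_of_order[where W = "tilt (Suc N)"])
         (use True rr m'_step[of n] m'_step[of "n - 1"] K in \<open>auto simp: r'r L'_def\<close>)
    have vv: "v k = r k * m k" "u k = r k * m' k" if "\<bar>k\<bar> \<le> L" for k
      using that K vr[of k] u_in[of k] r'r[of k] by (auto simp: m_def L'_def)
    have "(u (n + 1) + u (n - 1)) * v n = (v (n + 1) + v (n - 1)) * u n"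
      using True 1 2 by (simp add: vv)
    moreover have "0 \<le> (v (n + 1) + v (n - 1)) * u n"
      using vpos[of "n + 1"] vpos[of "n - 1"] u_half[of n] by simp
    ultimately show ?thesis
      using rate0[of N] by (simp add: close_up_def mult_le_cancel_right1)
  next
    case False
    have pm: "close_up \<sigma> (p (n - 1)) (p n)"
      using p_slow[of "n - 1"] False by simp
    have "close_up \<sigma> ((u (n + 1) + u (n - 1)) * v n) ((v (n + 1) + v (n - 1)) * u n)"
      unfolding u_def by (rule slow_factor_close_up) (use False p_slow[of n] pm vpos in auto)
    moreover have "\<sigma> \<le> 3 / 4 * rate N"
    proof -
      have "(2::real) ^ N \<le> 4 ^ N * 32"
        using power_mono[of "2::real" 4 N] zero_le_power[of "4::real" N] by linarith
      then show ?thesis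
        by (simp add: \<sigma>_def rate_def wall_def power_add field_simps)
    qed
    moreover have "0 \<le> (u (n + 1) + u (n - 1)) * v n" "0 \<le> (v (n + 1) + v (n - 1)) * u n"
      using vpos[of "n + 1"] vpos[of "n - 1"] vpos[of n] u_half[of n] u_half[of "n + 1"] u_half[of "n - 1"]
      by (auto intro!: mult_nonneg_nonneg add_nonneg_nonneg)
    ultimately show ?thesis
      using mult_right_mono[of "exp \<sigma>" "exp (3 / 4 * rate N)"] unfolding close_up_def
      by (meson exp_le_cancel_iff order_trans)
  qed
  define R where "R = L' + K2 + K1 + K1"
  have far: "u n = v n" if "R \<le> \<bar>n\<bar>" for n
  proof -
    have "h n \<le> - K1"
      using that K by (auto simp: h_def R_def)
    then have "rate (Suc N) * h n \<le> rate (Suc N) * (- K1)"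
      using rate0[of "Suc N"] by (intro mult_left_mono) linarith+
    then have "a n \<le> exp (- (rate (Suc N) * K1))"
      by (simp add: a_def)
    also have "\<dots> = 1 / exp (rate (Suc N) * K1)"
      by (simp add: exp_minus field_simps)
    also have "\<dots> \<le> 1 / (3 * 1)"
      using wall_growth[of N] wall1[of "Suc N"] by (intro divide_left_mono) (auto simp: K1_def)
    finally have "a n * m' n \<le> 1 / 3 * (3 / 2)"
      using m[of n] by (intro mult_mono) auto
    then have "x n \<le> 1"
      using m(1)[of n] by (simp add: x_def)
    moreover have "\<not> \<bar>n\<bar> \<le> L'"
      using that K by (auto simp: R_def)
    ultimately show ?thesis
      by (simp add: u_def p_def)
  qed
  have roomy_next: "roomy \<rho> (Suc N) u'" if u': "\<And>n. \<bar>n\<bar> \<le> R \<Longrightarrow> u' n = u n" for u'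
    unfolding roomy_def
  proof (intro exI conjI allI impI)
    have eq: "recip_sum r'' L' n = recip_sum r' L' n" for n
      by (rule recip_sum_cong) (simp add: r''_def)
    show "1 \<le> L'" using K L by (simp add: L'_def)
    then show "r'' 0 = 1" "r'' 1 = \<rho>"
      using L r01 aL[of 0] aL[of 1] by (auto simp: r''_def r'_def)
    show "recip_sum r'' L' L' \<le> budget (Suc N)"
      using bud' by (simp add: eq)
    show "1 \<le> r'' n" if "\<bar>n\<bar> \<le> L'" for n
      using that r'1 by (simp add: r''_def)
    show "u' n = r'' n * (1 + tilt (Suc N) * recip_sum r'' L' n)"
      if "\<bar>n\<bar> \<le> L' + run (Suc N + 1)" for n
      unfolding eq using u'[of n] that K u_in[of n] m(3)[of n]
      by (simp add: r''_def R_def K2_def flip: m'_def)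
    show "wall (Suc N) \<le> r'' n" if n: "L' \<le> \<bar>n\<bar> \<and> \<bar>n\<bar> \<le> L' + run (Suc N + 1)" for n
    proof -
      have big: "3 * wall (Suc N) \<le> a n"
        using n by (intro a_big) (auto simp: K2_def)
      show ?thesis
      proof (cases "\<bar>n\<bar> \<le> L'")
        case True
        have "1 * wall (Suc N) \<le> r n * a n"
          using big r1'[OF True] wall1[of "Suc N"] by (intro mult_mono) auto
        with True show ?thesis by (simp add: r''_def r'_def)
      next
        case False
        have "1 / 2 * (3 * wall (Suc N)) \<le> v n * a n"
          using v[of n] big wall1[of "Suc N"] by (intro mult_mono) auto
        then have "wall (Suc N) \<le> v n * a n / (3 / 2)"
          by simp
        also have "\<dots> \<le> v n * a n / m n"
          using m[of n] vpos[of n] by (intro divide_left_mono) (auto simp: a_def)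
        also have "\<dots> = v n * x n / m' n"
          using m(3)[of n] by (simp add: x_def)
        also have "\<dots> \<le> u n / m' n"
          using False vpos[of n] m(3)[of n]
          by (intro divide_right_mono) (auto simp: u_def p_def)
        finally show ?thesis using False by (simp add: r''_def)
      qed
    qed
  qed
  have "1 \<le> R" using K L by (simp add: R_def L'_def)
  then show ?thesis
    by (rule that[OF _ u_half far near roomy_next])
qed

section \<open>Perturbing a function along an orbit of the rotation\<close>

lemma antiderivative_on_line:
  fixes f :: "real \<Rightarrow> real"
  assumes "continuous_on UNIV f"
  obtains F where "\<And>x. (F has_real_derivative f x) (at x)"
proof -
  have "\<exists>F. \<forall>x :: real. -\<infinity> < ereal x \<longrightarrow> ereal x < \<infinity> \<longrightarrow> (F has_vector_derivative f x) (at x)"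
    by (rule einterval_antiderivative) (use assms in \<open>auto simp: continuous_on_eq_continuous_at\<close>)
  then show ?thesis
    using that by (auto simp: has_real_derivative_iff_has_vector_derivative)
qed

lemma periodic_add_of_int:
  fixes F :: "real \<Rightarrow> real"
  assumes "\<And>x. F (x + 1) = F x"
  shows "F (x + of_int k) = F x"
  using quasi_periodic_add_of_int[of F 0] assms by simp

lemma periodic_derivative_quasi_periodic:
  fixes F f :: "real \<Rightarrow> real"
  assumes "\<And>x. (F has_real_derivative f x) (at x)" and "\<And>x. f (x + 1) = f x"
  shows "F (x + 1) = F x + (F 1 - F 0)"
proof -
  have "((\<lambda>x. F (x + 1) - F x) has_real_derivative 0) (at x)" for x
  proof -
    have "((\<lambda>x. F (x + 1)) has_real_derivative f x) (at x)"
      using assms(1)[of "x + 1"] assms(2)[of x] by (simp add: DERIV_shift)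
    from DERIV_diff[OF this assms(1)] show ?thesis by simp
  qed
  then have "F (x + 1) - F x = F (0 + 1) - F 0"
    by (intro DERIV_isconst_all) blast
  then show ?thesis by simp
qed

lemma cos_less_near_integer:
  assumes "0 \<le> q" "q \<le> 1 / 2" "cos (2 * pi * q) < cos (2 * pi * x)"
  shows "\<exists>j::int. \<bar>x - j\<bar> < q"
proof (rule exI, rule ccontr)
  let ?y = "x - round x"
  assume "\<not> \<bar>?y\<bar> < q"
  moreover have "\<bar>?y\<bar> \<le> 1 / 2"
    using of_int_round_abs_le[of x] by (simp add: abs_minus_commute)
  ultimately have "cos (2 * pi * \<bar>?y\<bar>) \<le> cos (2 * pi * q)"
    using assms(1) by (intro cos_monotone_0_pi_le) auto
  moreover have "cos (2 * pi * \<bar>?y\<bar>) = cos (2 * pi * ?y)"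
    by (cases "0 \<le> ?y") (simp_all add: abs_if right_diff_distrib cos_diff)
  moreover have "cos (2 * pi * ?y) = cos (2 * pi * x)"
    using cos_int_2pin[of "round x"] sin_int_2pin[of "round x"]
    by (simp add: right_diff_distrib cos_diff)
  ultimately show False using assms(3) by simp
qed

text \<open>
  The positive part of an affine function of \<open>cos (2 \<pi> x)\<close> is a convenient continuous bump. Its primitive
  gains at most \<open>2 \<delta>\<close> per period, which yields the bound on its increments.
\<close>

lemma thin_periodic_bump:
  fixes \<delta> :: real
  assumes "0 < \<delta>"
  obtains b P :: "real \<Rightarrow> real" where
    "continuous_on UNIV b" "\<And>x. b (x + 1) = b x" "\<And>x. 0 \<le> b x" "\<And>x. b x \<le> 1" "b 0 = 1"
    "\<And>x. b x \<noteq> 0 \<Longrightarrow> \<exists>j::int. \<bar>x - j\<bar> < \<delta>"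
    "\<And>x. (P has_real_derivative b x) (at x)"
    "\<And>x y. x \<le> y \<Longrightarrow> \<bar>P y - P x\<bar> \<le> 2 * \<delta> * (y - x + 1)"
proof -
  define q where "q = min \<delta> (1 / 4)"
  have q: "0 < q" "q \<le> \<delta>" "q \<le> 1 / 4" using assms by (auto simp: q_def)
  define c where "c = cos (2 * pi * q)"
  have "c < cos 0"
    unfolding c_def using q by (intro cos_monotone_0_pi) (auto simp: field_simps)
  then have c: "c < 1" by simp
  define b where "b x = max 0 ((cos (2 * pi * x) - c) / (1 - c))" for x
  have cont: "continuous_on UNIV b"
    unfolding b_def using c by (intro continuous_intros) auto
  have per: "b (x + 1) = b x" for x
    by (simp add: b_def distrib_left)
  have b01: "0 \<le> b x" "b x \<le> 1" for x
    using c by (auto simp: b_def)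
  have b0: "b 0 = 1" using c by (simp add: b_def)
  have supp: "\<exists>j::int. \<bar>x - j\<bar> < q" if "b x \<noteq> 0" for x
  proof (rule cos_less_near_integer)
    have "0 < (cos (2 * pi * x) - c) / (1 - c)"
      using that by (auto simp: b_def max_def less_le split: if_splits)
    with c show "cos (2 * pi * q) < cos (2 * pi * x)"
      by (simp add: c_def[symmetric] zero_less_divide_iff)
  qed (use q in auto)
  obtain P where P: "\<And>x. (P has_real_derivative b x) (at x)"
    using antiderivative_on_line[OF cont] by blast
  define \<iota> where "\<iota> = P 1 - P 0"
  have mono: "P x \<le> P y" if "x \<le> y" for x y
    by (rule DERIV_nonneg_imp_nondecreasing[OF that]) (use P b01 in blast)
  have lip: "P y - P x \<le> y - x" if "x \<le> y" for x y
  proof -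
    have "x - P x \<le> y - P y"
    proof (rule DERIV_nonneg_imp_nondecreasing[OF that])
      fix t show "\<exists>d. ((\<lambda>t. t - P t) has_real_derivative d) (at t) \<and> 0 \<le> d"
        using b01[of t] by (intro exI[of _ "1 - b t"]) (auto intro!: derivative_eq_intros P)
    qed
    then show ?thesis by simp
  qed
  have "P (1 - q) \<le> P q"
  proof (rule DERIV_nonpos_imp_nonincreasing[where f = P and a = q and b = "1 - q"])
    fix t assume t: "q \<le> t" "t \<le> 1 - q"
    have "b t = 0"
    proof (rule ccontr)
      assume "b t \<noteq> 0"
      then obtain j :: int where "\<bar>t - j\<bar> < q" using supp by blast
      then have "0 < real_of_int j" "real_of_int j < 1" using t q by linarith+
      then show False by auto
    qed
    then show "\<exists>d. (P has_real_derivative d) (at t) \<and> d \<le> 0"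
      using P[of t] by auto
  qed (use q in auto)
  then have \<iota>: "\<iota> \<le> 2 * q"
    using lip[of 0 q] lip[of "1 - q" 1] q by (simp add: \<iota>_def)
  have \<iota>0: "0 \<le> \<iota>" using mono[of 0 1] by (simp add: \<iota>_def)
  have bound: "\<bar>P y - P x\<bar> \<le> 2 * \<delta> * (y - x + 1)" if "x \<le> y" for x y
  proof -
    have "y \<le> x + of_int \<lceil>y - x\<rceil>"
      using le_of_int_ceiling[of "y - x"] by linarith
    then have "P y \<le> P (x + of_int \<lceil>y - x\<rceil>)"
      by (rule mono)
    also have "\<dots> = P x + of_int \<lceil>y - x\<rceil> * \<iota>"
      unfolding \<iota>_def
      by (rule quasi_periodic_add_of_int, rule periodic_derivative_quasi_periodic[where f = b]) (auto simp: P per)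
    also have "of_int \<lceil>y - x\<rceil> * \<iota> \<le> (y - x + 1) * (2 * q)"
      using that \<iota> \<iota>0 q by (intro mult_mono) (linarith+)
    also have "\<dots> \<le> (y - x + 1) * (2 * \<delta>)"
      using that q by (intro mult_left_mono) auto
    finally show ?thesis using mono[OF that] by (simp add: algebra_simps)
  qed
  have supp': "\<exists>j::int. \<bar>x - j\<bar> < \<delta>" if "b x \<noteq> 0" for x
    using supp[OF that] q(2) by (meson order_less_le_trans)
  show ?thesis
    by (rule that[of b P, OF cont per b01 b0 supp' P bound])
qed

lemma irrational_multiple_not_int:
  assumes "\<alpha> \<notin> \<rat>" "n \<noteq> 0"
  shows "of_int n * \<alpha> \<notin> \<int>"
proof
  assume "of_int n * \<alpha> \<in> \<int>"
  then obtain k where "of_int n * \<alpha> = of_int k" by (auto elim: Ints_cases)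
  then have "\<alpha> = of_int k / of_int n" using assms(2) by (simp add: field_simps)
  with assms(1) show False by (metis Rats_divide Rats_of_int)
qed

lemma irrational_multiples_apart:
  fixes \<alpha> :: real
  assumes "\<alpha> \<notin> \<rat>"
  obtains \<delta> where "0 < \<delta>" "\<And>n j :: int. n \<noteq> 0 \<Longrightarrow> \<bar>n\<bar> \<le> M \<Longrightarrow> \<delta> \<le> \<bar>of_int n * \<alpha> - of_int j\<bar>"
proof -
  have "\<forall>\<^sub>F \<delta> in at_right 0. \<forall>j::int. \<delta> \<le> \<bar>of_int n * \<alpha> - of_int j\<bar>" if n: "n \<noteq> 0" for n :: int
  proof -
    have "open (- \<int> :: real set)" by (simp add: open_Compl)
    then obtain e where e: "0 < e" "ball (of_int n * \<alpha>) e \<subseteq> - \<int>"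
      using irrational_multiple_not_int[OF assms n] by (meson ComplI open_contains_ball)
    have "\<delta> \<le> \<bar>of_int n * \<alpha> - of_int j\<bar>" if "\<delta> < e" for \<delta> and j :: int
    proof (rule ccontr)
      assume "\<not> ?thesis"
      then have "of_int j \<in> ball (of_int n * \<alpha>) e"
        using that by (simp add: dist_real_def)
      with e(2) show False by auto
    qed
    then show ?thesis
      using eventually_at_right_less e(1) unfolding eventually_at_right_field by blast
  qed
  then have "\<forall>\<^sub>F \<delta> in at_right 0. \<forall>n\<in>{-M..M} - {0}. \<forall>j::int. \<delta> \<le> \<bar>of_int n * \<alpha> - of_int j\<bar>"
    by (intro eventually_ball_finite) auto
  moreover have "\<forall>\<^sub>F \<delta> in at_right (0::real). 0 < \<delta>"
    by (rule eventually_at_right_less)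
  ultimately have "\<forall>\<^sub>F \<delta> in at_right 0. 0 < \<delta> \<and> (\<forall>n\<in>{-M..M} - {0}. \<forall>j::int. \<delta> \<le> \<bar>of_int n * \<alpha> - of_int j\<bar>)"
    by eventually_elim blast
  from eventually_happens[OF this]
  obtain \<delta> where "0 < \<delta>" "\<forall>n\<in>{-M..M} - {0}. \<forall>j::int. \<delta> \<le> \<bar>of_int n * \<alpha> - of_int j\<bar>"
    by auto
  then show ?thesis by (intro that[of \<delta>]) (auto simp: abs_le_iff)
qed

lemma eventually_pos_at_0:
  fixes g :: "real \<Rightarrow> real"
  assumes "continuous_on UNIV g" "0 < g 0"
  shows "\<forall>\<^sub>F s in nhds 0. 0 < g s"
  using open_Collect_less[OF continuous_on_const assms(1), of 0] assms(2)
  unfolding eventually_nhds by blast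

lemma segment_le:
  fixes t x y X Y :: real
  assumes "x \<le> y" "x + X \<le> y + Y" "0 \<le> t" "t \<le> 1"
  shows "x + t * X \<le> y + t * Y"
proof -
  have "0 \<le> (1 - t) * (y - x) + t * ((y + Y) - (x + X))"
    using assms by (intro add_nonneg_nonneg mult_nonneg_nonneg) simp_all
  then show ?thesis by (simp add: algebra_simps)
qed

text \<open>
  Prescribed values \<open>u\<close> on a finite piece of the orbit of \<open>0\<close> are attained by adding to \<open>v\<close> a
  combination of translated bumps with disjoint supports. For a point near the orbit point number \<open>n\<close>,
  the values of \<open>v'\<close> at it and at its two neighbours are \<open>v + t A\<close> with one common bump height
  \<open>t \<in> [0, 1]\<close>. The comparison of \<open>c[v']\<close> with \<open>c[v]\<close>, cleared of denominators, is affine in \<open>t\<close>; it is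
  trivial for \<open>t = 0\<close>, and for \<open>t = 1\<close> it holds on the orbit of \<open>0\<close> by assumption and nearby by
  continuity, at the price of passing from \<open>\<sigma>\<close> to \<open>\<sigma>'\<close>.
\<close>

lemma perturb_along_orbit:
  fixes v H :: "real \<Rightarrow> real" and u :: "int \<Rightarrow> real"
  assumes \<alpha>: "\<alpha> \<notin> \<rat>"
    and v: "continuous_on UNIV v" "\<And>x. v (x + 1) = v x" "\<And>x. 1 / 2 < v x"
    and H: "\<And>x. (H has_real_derivative v x) (at x)"
    and u: "1 \<le> R" "\<And>n. 1 / 2 < u n" "\<And>n. R \<le> \<bar>n\<bar> \<Longrightarrow> u n = v (of_int n * \<alpha>)"
    and near: "\<And>n. close_up \<sigma> ((u (n + 1) + u (n - 1)) * v (of_int n * \<alpha>))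
                 ((v (of_int (n + 1) * \<alpha>) + v (of_int (n - 1) * \<alpha>)) * u n)"
    and "\<sigma> < \<sigma>'" "0 \<le> \<sigma>'" "0 < \<eta>"
  obtains v' H' where
    "continuous_on UNIV v'" "\<And>x. v' (x + 1) = v' x" "\<And>x. 1 / 2 < v' x"
    "\<And>x. (H' has_real_derivative v' x) (at x)"
    "\<And>n. \<bar>n\<bar> \<le> R \<Longrightarrow> v' (of_int n * \<alpha>) = u n"
    "\<And>x. close_up \<sigma>' ((v' (x + \<alpha>) + v' (x - \<alpha>)) * v x) ((v (x + \<alpha>) + v (x - \<alpha>)) * v' x)"
    "\<And>x y. x \<le> y \<Longrightarrow> \<bar>(H' y - H' x) - (H y - H x)\<bar> \<le> \<eta> * (y - x + 1)"
proof -
  define A where "A n = u n - v (of_int n * \<alpha>)" for n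
  have A0: "A n = 0" if "R \<le> \<bar>n\<bar>" for n using u(3)[OF that] by (simp add: A_def)
  define S where "S n s = v (of_int (n + 1) * \<alpha> + s) + v (of_int (n - 1) * \<alpha> + s)" for n s
  \<comment> \<open>\<open>X n s\<close> and \<open>Y n s\<close> are the two sides to be compared at full bump height \<open>t = 1\<close>, at the point
    displaced by \<open>s\<close> from the orbit point number \<open>n\<close>.\<close>
  define X where "X n s = (S n s + (A (n + 1) + A (n - 1))) * v (of_int n * \<alpha> + s)" for n s
  define Y where "Y n s = S n s * (v (of_int n * \<alpha> + s) + A n)" for n s
  have cont_v: "continuous_on UNIV (\<lambda>s. v (c + s))" for c
    by (rule continuous_on_compose2[OF v(1)]) (auto intro!: continuous_intros)
  have contXY: "continuous_on UNIV (X n)" "continuous_on UNIV (Y n)" for n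
    unfolding X_def Y_def S_def by (intro continuous_intros cont_v)+
  define good where "good n s \<longleftrightarrow> 0 < (v (of_int n * \<alpha> + s) + A n) - 1 / 2 \<and>
      0 < exp \<sigma>' * Y n s - X n s \<and> 0 < exp \<sigma>' * X n s - Y n s" for n s
  have good: "\<forall>\<^sub>F s in nhds 0. good n s" for n
  proof -
    have XY0: "X n 0 = (u (n + 1) + u (n - 1)) * v (of_int n * \<alpha>)"
      "Y n 0 = (v (of_int (n + 1) * \<alpha>) + v (of_int (n - 1) * \<alpha>)) * u n"
      by (simp_all add: X_def Y_def S_def A_def)
    have vp: "0 < v x" "0 < u k" for x k using v(3)[of x] u(2)[of k] by simp_all
    have pos: "0 < X n 0" "0 < Y n 0"
      unfolding XY0 by (intro mult_pos_pos add_pos_pos vp)+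
    have "X n 0 \<le> exp \<sigma> * Y n 0" "Y n 0 \<le> exp \<sigma> * X n 0"
      using near[of n] by (simp_all add: XY0 close_up_def)
    moreover have "exp \<sigma> * Y n 0 < exp \<sigma>' * Y n 0" "exp \<sigma> * X n 0 < exp \<sigma>' * X n 0"
      using pos \<open>\<sigma> < \<sigma>'\<close> by simp_all
    ultimately have *: "0 < exp \<sigma>' * Y n 0 - X n 0" "0 < exp \<sigma>' * X n 0 - Y n 0"
      by linarith+
    show ?thesis
      unfolding good_def
      by (intro eventually_conj eventually_pos_at_0 * continuous_intros contXY cont_v)
         (use u(2)[of n] in \<open>simp add: A_def\<close>)
  qed
  have "\<forall>\<^sub>F s in nhds 0. \<forall>n\<in>{-R..R}. good n s"
    by (intro eventually_ball_finite) (auto simp: good)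
  then obtain \<delta>1 where \<delta>1: "0 < \<delta>1" "\<And>n s. \<bar>n\<bar> \<le> R \<Longrightarrow> \<bar>s\<bar> < \<delta>1 \<Longrightarrow> good n s"
    unfolding eventually_nhds_metric by (auto simp: dist_real_def abs_le_iff)
  \<comment> \<open>Two bumps belong to indices differing by at most \<open>2 R + 1\<close>; this includes the neighbours of the
    outermost ones.\<close>
  obtain \<delta>2 where \<delta>2: "0 < \<delta>2"
    "\<And>n j :: int. n \<noteq> 0 \<Longrightarrow> \<bar>n\<bar> \<le> 2 * R + 1 \<Longrightarrow> \<delta>2 \<le> \<bar>of_int n * \<alpha> - of_int j\<bar>"
    using irrational_multiples_apart[OF \<alpha>, of "2 * R + 1"] by blast
  define tot where "tot = (\<Sum>n\<in>{-R..R}. \<bar>A n\<bar>)"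
  have tot0: "0 \<le> tot" by (simp add: tot_def sum_nonneg)
  define \<delta> where "\<delta> = min \<delta>1 (min (\<delta>2 / 2) (\<eta> / (2 * (tot + 1))))"
  have \<delta>: "0 < \<delta>" "\<delta> \<le> \<delta>1" "2 * \<delta> \<le> \<delta>2" "\<delta> \<le> \<eta> / (2 * (tot + 1))"
    using \<delta>1 \<delta>2 tot0 \<open>0 < \<eta>\<close> by (auto simp: \<delta>_def)
  obtain b P where b: "continuous_on UNIV b" "\<And>x. b (x + 1) = b x" "\<And>x. 0 \<le> b x" "\<And>x. b x \<le> 1" "b 0 = 1"
    "\<And>x. b x \<noteq> 0 \<Longrightarrow> \<exists>j::int. \<bar>x - j\<bar> < \<delta>"
    and P: "\<And>x. (P has_real_derivative b x) (at x)"
    "\<And>x y. x \<le> y \<Longrightarrow> \<bar>P y - P x\<bar> \<le> 2 * \<delta> * (y - x + 1)"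
    using thin_periodic_bump[OF \<delta>(1)] by metis
  define e where "e x = (\<Sum>n\<in>{-R..R}. A n * b (x - of_int n * \<alpha>))" for x
  have e_at: "e x = A k * b (x - of_int k * \<alpha>)" if k: "\<bar>k\<bar> \<le> R + 1" and bk: "b (x - of_int k * \<alpha>) \<noteq> 0" for x k
  proof -
    have "b (x - of_int n * \<alpha>) = 0" if n: "n \<in> {-R..R}" "n \<noteq> k" for n
    proof (rule ccontr)
      assume "b (x - of_int n * \<alpha>) \<noteq> 0"
      then obtain i j :: int where "\<bar>x - of_int n * \<alpha> - i\<bar> < \<delta>" "\<bar>x - of_int k * \<alpha> - j\<bar> < \<delta>"
        using b(6) bk by blast
      then have "\<bar>of_int (n - k) * \<alpha> - of_int (j - i)\<bar> < 2 * \<delta>"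
        by (simp add: left_diff_distrib)
      moreover have "\<delta>2 \<le> \<bar>of_int (n - k) * \<alpha> - of_int (j - i)\<bar>"
        using n k by (intro \<delta>2) auto
      ultimately show False using \<delta>(3) by linarith
    qed
    then have "e x = (\<Sum>n\<in>{-R..R}. if n = k then A k * b (x - of_int k * \<alpha>) else 0)"
      unfolding e_def by (intro sum.cong) auto
    also have "\<dots> = A k * b (x - of_int k * \<alpha>)"
      using A0[of k] by auto
    finally show ?thesis .
  qed
  have e_off: "e x = 0" "e (x + \<alpha>) = 0" "e (x - \<alpha>) = 0"
    if off: "\<And>k. \<bar>k\<bar> \<le> R \<Longrightarrow> b (x - of_int k * \<alpha>) = 0" for x
  proof -
    show "e x = 0" unfolding e_def by (intro sum.neutral) (auto simp: off)
    have sh: "x + \<alpha> - of_int n * \<alpha> = x - of_int (n - 1) * \<alpha>"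
      "x - \<alpha> - of_int n * \<alpha> = x - of_int (n + 1) * \<alpha>" for n
      by (simp_all add: algebra_simps)
    have "A n * b (x - of_int (n - 1) * \<alpha>) = 0" if "n \<in> {-R..R}" for n
    proof -
      have "\<bar>n - 1\<bar> \<le> R \<or> R \<le> \<bar>n\<bar>" using that by auto
      then show ?thesis using off[of "n - 1"] A0[of n] by auto
    qed
    then show "e (x + \<alpha>) = 0"
      unfolding e_def sh by (intro sum.neutral) blast
    have "A n * b (x - of_int (n + 1) * \<alpha>) = 0" if "n \<in> {-R..R}" for n
    proof -
      have "\<bar>n + 1\<bar> \<le> R \<or> R \<le> \<bar>n\<bar>" using that by auto
      then show ?thesis using off[of "n + 1"] A0[of n] by auto
    qed
    then show "e (x - \<alpha>) = 0"
      unfolding e_def sh by (intro sum.neutral) blast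
  qed
  define v' where "v' x = v x + e x" for x
  define H' where "H' x = H x + (\<Sum>n\<in>{-R..R}. A n * P (x - of_int n * \<alpha>))" for x
  have vper: "v (x + of_int j) = v x" for x j
    using v(2) by (rule periodic_add_of_int)
  have local: "1 / 2 < v' x \<and>
      close_up \<sigma>' ((v' (x + \<alpha>) + v' (x - \<alpha>)) * v x) ((v (x + \<alpha>) + v (x - \<alpha>)) * v' x)" for x
  proof (cases "\<forall>k. \<bar>k\<bar> \<le> R \<longrightarrow> b (x - of_int k * \<alpha>) = 0")
    case True
    have "0 < v y" for y using v(3)[of y] by simp
    then have "0 \<le> (v (x + \<alpha>) + v (x - \<alpha>)) * v x"
      by (simp add: less_imp_le add_nonneg_nonneg)
    moreover have "e x = 0" "e (x + \<alpha>) = 0" "e (x - \<alpha>) = 0"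
      using e_off[of x] True by blast+
    ultimately show ?thesis
      using v(3)[of x] \<open>0 \<le> \<sigma>'\<close> by (simp add: v'_def close_up_def mult_le_cancel_right1)
  next
    case False
    then obtain k where k: "\<bar>k\<bar> \<le> R" "b (x - of_int k * \<alpha>) \<noteq> 0" by blast
    define t where "t = b (x - of_int k * \<alpha>)"
    have t: "0 \<le> t" "t \<le> 1" using b(3,4) by (auto simp: t_def)
    obtain j :: int where j: "\<bar>x - of_int k * \<alpha> - j\<bar> < \<delta>" using b(6)[OF k(2)] by blast
    define s where "s = x - of_int k * \<alpha> - j"
    have g: "good k s" using j \<delta>(2) k(1) by (intro \<delta>1) (auto simp: s_def)
    have xs: "x = of_int k * \<alpha> + s + of_int j" "x + \<alpha> = of_int (k + 1) * \<alpha> + s + of_int j"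
      "x - \<alpha> = of_int (k - 1) * \<alpha> + s + of_int j"
      by (simp_all add: s_def algebra_simps)
    have sh: "x + \<alpha> - of_int (k + 1) * \<alpha> = x - of_int k * \<alpha>" "x - \<alpha> - of_int (k - 1) * \<alpha> = x - of_int k * \<alpha>"
      by (simp_all add: algebra_simps)
    have ex: "e x = t * A k" "e (x + \<alpha>) = t * A (k + 1)" "e (x - \<alpha>) = t * A (k - 1)"
      using e_at[of k x] e_at[of "k + 1" "x + \<alpha>"] e_at[of "k - 1" "x - \<alpha>"] k
      unfolding sh t_def by (simp_all add: mult.commute)
    define V where "V = v (of_int k * \<alpha> + s)"
    have vx: "v x = V" "v (x + \<alpha>) + v (x - \<alpha>) = S k s"
      unfolding V_def S_def xs(2,3) vper by (subst xs(1)) (rule vper refl)+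
    have V: "1 / 2 < V" using v(3) by (simp add: V_def)
    have S: "0 \<le> S k s" using v(3)[of "of_int (k + 1) * \<alpha> + s"] v(3)[of "of_int (k - 1) * \<alpha> + s"]
      by (simp add: S_def)
    have SV: "0 \<le> S k s * V" using S V by simp
    define B where "B = A (k + 1) + A (k - 1)"
    have g': "1 / 2 < V + A k" "S k s * V + B * V \<le> exp \<sigma>' * (S k s * V) + exp \<sigma>' * (S k s * A k)"
      "S k s * V + S k s * A k \<le> exp \<sigma>' * (S k s * V) + exp \<sigma>' * (B * V)"
      using g unfolding good_def X_def Y_def V_def[symmetric] B_def[symmetric]
      by (simp_all add: algebra_simps)
    have SV': "S k s * V \<le> exp \<sigma>' * (S k s * V)"
      using SV \<open>0 \<le> \<sigma>'\<close> by (simp add: mult_le_cancel_right1)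
    have "1 / 2 < V + t * A k"
    proof -
      have "(1 - t) * (1 / 2) + t * (1 / 2) < (1 - t) * V + t * (V + A k)"
      proof (cases "t = 0")
        case False
        then show ?thesis using t V g'(1)
          by (intro add_le_less_mono mult_left_mono mult_strict_left_mono) auto
      qed (use V in simp)
      moreover have "(1 - t) * (1 / 2) + t * (1 / 2) = (1 / 2 :: real)"
        "(1 - t) * V + t * (V + A k) = V + t * A k"
        by (simp_all add: field_simps)
      ultimately show ?thesis by (simp only:)
    qed
    moreover have "S k s * V + t * (B * V) \<le> exp \<sigma>' * (S k s * V) + t * (exp \<sigma>' * (S k s * A k))"
      using SV' g'(2) t by (rule segment_le)
    moreover have "S k s * V + t * (S k s * A k) \<le> exp \<sigma>' * (S k s * V) + t * (exp \<sigma>' * (B * V))"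
      using SV' g'(3) t by (rule segment_le)
    moreover have "v' x = V + t * A k" "v' (x + \<alpha>) + v' (x - \<alpha>) = S k s + t * B"
      using vx(2) unfolding v'_def ex vx(1) B_def distrib_left by linarith+
    ultimately show ?thesis
      unfolding vx close_up_def by (simp add: algebra_simps)
  qed
  show ?thesis
  proof (rule that[of v' H'])
    have "continuous_on UNIV (\<lambda>x. b (x - c))" for c
      by (rule continuous_on_compose2[OF b(1)]) (auto intro!: continuous_intros)
    then show "continuous_on UNIV v'"
      unfolding v'_def e_def by (intro continuous_intros v(1))
    show "v' (x + 1) = v' x" for x
    proof -
      have "b (x + 1 - c) = b (x - c)" for c
        using b(2)[of "x - c"] by (simp add: algebra_simps)
      then show ?thesis by (simp add: v'_def e_def v(2))
    qed
    show "1 / 2 < v' x" for x using local by blast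
    show "close_up \<sigma>' ((v' (x + \<alpha>) + v' (x - \<alpha>)) * v x) ((v (x + \<alpha>) + v (x - \<alpha>)) * v' x)" for x
      using local by blast
    show "(H' has_real_derivative v' x) (at x)" for x
    proof -
      have "((\<lambda>x. P (x - c)) has_real_derivative b (x - c)) (at x)" for c
        using P(1)[of "x + - c"] by (subst (asm) DERIV_shift) simp
      then show ?thesis
        unfolding H'_def v'_def e_def
        by (intro DERIV_add H DERIV_sum DERIV_cmult)
    qed
    show "v' (of_int n * \<alpha>) = u n" if "\<bar>n\<bar> \<le> R" for n
      using e_at[of n "of_int n * \<alpha>"] that b(5) by (simp add: v'_def A_def)
    show "\<bar>(H' y - H' x) - (H y - H x)\<bar> \<le> \<eta> * (y - x + 1)" if "x \<le> y" for x y
    proof -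
      have "(H' y - H' x) - (H y - H x) =
          (\<Sum>n\<in>{-R..R}. A n * (P (y - of_int n * \<alpha>) - P (x - of_int n * \<alpha>)))"
        by (simp add: H'_def right_diff_distrib sum_subtractf)
      also have "\<bar>\<dots>\<bar> \<le> (\<Sum>n\<in>{-R..R}. \<bar>A n\<bar> * (2 * \<delta> * (y - x + 1)))"
      proof (rule order_trans[OF sum_abs], rule sum_mono)
        fix n :: int
        have "\<bar>P (y - of_int n * \<alpha>) - P (x - of_int n * \<alpha>)\<bar> \<le> 2 * \<delta> * (y - x + 1)"
          using P(2)[of "x - of_int n * \<alpha>" "y - of_int n * \<alpha>"] that by simp
        then show "\<bar>A n * (P (y - of_int n * \<alpha>) - P (x - of_int n * \<alpha>))\<bar> \<le> \<bar>A n\<bar> * (2 * \<delta> * (y - x + 1))"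
          unfolding abs_mult by (intro mult_left_mono) auto
      qed
      also have "\<dots> = tot * (2 * \<delta>) * (y - x + 1)"
        by (simp only: tot_def sum_distrib_right mult.assoc)
      also have "\<dots> \<le> \<eta> * (y - x + 1)"
      proof (rule mult_right_mono)
        have "tot * (2 * \<delta>) \<le> (tot + 1) * (2 * \<delta>)"
          using \<delta>(1) by (intro mult_right_mono) auto
        also have "\<dots> \<le> \<eta>" using \<delta>(4) tot0 by (simp add: field_simps)
        finally show "tot * (2 * \<delta>) \<le> \<eta>" .
      qed (use that in simp)
      finally show ?thesis .
    qed
  qed
qed

section \<open>The stages and their limit\<close>

text \<open>
  Applied to \<open>v\<close> this is the numerator of \<open>c\<close>; applied to a primitive \<open>G\<close> it is \<open>f + f\<inverse>\<close> in the
  coordinate \<open>x\<close>.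
\<close>

definition nbr_sum :: "real \<Rightarrow> (real \<Rightarrow> real) \<Rightarrow> real \<Rightarrow> real" where
  "nbr_sum \<alpha> v x = v (x + \<alpha>) + v (x - \<alpha>)"

text \<open>
  The number \<open>s\<close> is a scale at which the difference quotients of \<open>H\<close> at \<open>0\<close> and at \<open>\<alpha>\<close> still show the
  values of \<open>v\<close>. The increments of all later primitives will be controlled relative to \<open>s\<close>, so this
  remains true in the limit.
\<close>

definition stage :: "real \<Rightarrow> real \<Rightarrow> nat \<Rightarrow> (real \<Rightarrow> real) \<times> (real \<Rightarrow> real) \<times> real \<Rightarrow> bool" where
  "stage \<alpha> \<rho> N = (\<lambda>(v, H, s).
     continuous_on UNIV v \<and> (\<forall>x. v (x + 1) = v x) \<and> (\<forall>x. 1 / 2 < v x) \<and>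
     (\<forall>x. (H has_real_derivative v x) (at x)) \<and>
     roomy \<rho> N (\<lambda>n. v (of_int n * \<alpha>)) \<and>
     0 < s \<and> s \<le> rate N \<and>
     \<bar>H s - H 0 - v 0 * s\<bar> \<le> rate N * s \<and> \<bar>H (\<alpha> + s) - H \<alpha> - v \<alpha> * s\<bar> \<le> rate N * s)"

definition refines :: "real \<Rightarrow> nat \<Rightarrow> (real \<Rightarrow> real) \<times> (real \<Rightarrow> real) \<times> real
    \<Rightarrow> (real \<Rightarrow> real) \<times> (real \<Rightarrow> real) \<times> real \<Rightarrow> bool" where
  "refines \<alpha> N = (\<lambda>(v, H, s) (v', H', s').
     (\<forall>x. close_up (rate N) (nbr_sum \<alpha> v' x * v x) (nbr_sum \<alpha> v x * v' x)) \<and>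
     (\<forall>x y. x \<le> y \<longrightarrow> \<bar>(H' y - H' x) - (H y - H x)\<bar> \<le> rate N * s * (y - x + 1)) \<and>
     s' \<le> s)"

lemma rate_pos: "0 < rate N" and rate_le_one: "rate N \<le> 1" and rate_Suc: "rate (Suc N) = rate N / 2"
  by (simp_all add: rate_def field_simps)

lemma rate_tendsto: "rate \<longlonglongrightarrow> 0"
  unfolding rate_def using LIMSEQ_inverse_realpow_zero[of 2] by (simp add: inverse_eq_divide)

lemma derivative_at_right:
  assumes "(H has_real_derivative D) (at c)" "0 < k"
  shows "\<forall>\<^sub>F s in at_right 0. \<bar>H (c + s) - H c - D * s\<bar> \<le> k * s"
proof -
  have "((\<lambda>s. (H (c + s) - H c) / s) \<longlongrightarrow> D) (at_right 0)"
    using assms(1) unfolding DERIV_def by (rule tendsto_within_subset) simp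
  then have "\<forall>\<^sub>F s in at_right 0. dist ((H (c + s) - H c) / s) D < k"
    using assms(2) by (rule tendstoD)
  then show ?thesis
    using eventually_at_right_less[of 0]
  proof eventually_elim
    case (elim s)
    have "H (c + s) - H c - D * s = ((H (c + s) - H c) / s - D) * s"
      using elim by (simp add: field_simps)
    then have "\<bar>H (c + s) - H c - D * s\<bar> = \<bar>(H (c + s) - H c) / s - D\<bar> * s"
      using elim by (simp add: abs_mult)
    also have "\<dots> \<le> k * s"
      using elim by (intro mult_right_mono) (auto simp: dist_real_def)
    finally show ?case .
  qed
qed

lemma test_scale:
  assumes "\<And>x. (H has_real_derivative v x) (at x)" "0 < k" "0 < B"
  obtains s where "0 < s" "s \<le> B" "\<bar>H s - H 0 - v 0 * s\<bar> \<le> k * s"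
    "\<bar>H (\<alpha> + s) - H \<alpha> - v \<alpha> * s\<bar> \<le> k * s"
proof -
  have "\<forall>\<^sub>F s in at_right 0. 0 < s \<and> s \<le> B \<and> \<bar>H (0 + s) - H 0 - v 0 * s\<bar> \<le> k * s \<and>
     \<bar>H (\<alpha> + s) - H \<alpha> - v \<alpha> * s\<bar> \<le> k * s"
    using assms(2,3)
    by (intro eventually_conj derivative_at_right assms(1) eventually_at_right_less)
       (auto simp: eventually_at_right_field intro: exI[of _ B])
  from eventually_happens[OF this] that show ?thesis by auto
qed

text \<open>
  The starting function equals \<open>1\<close> at \<open>0\<close> and is a large multiple of \<open>1 - cos (2 \<pi> x)\<close> above \<open>1\<close>, large enough
  to exceed the first wall at the finitely many orbit points involved; its \<open>c\<close> may be huge, because only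
  the later relative changes of \<open>c\<close> matter. The number \<open>\<rho>\<close> is the value at \<open>\<alpha>\<close>.
\<close>

lemma stage_zero:
  assumes \<alpha>: "\<alpha> \<notin> \<rat>"
  obtains \<rho> st where "1 \<le> \<rho>" "stage \<alpha> \<rho> 0 st"
proof -
  define M where "M = 1 + run 1"
  have pos: "0 < 1 - cos (2 * pi * (of_int n * \<alpha>))" if "n \<noteq> 0" for n
  proof -
    have "cos (2 * pi * (of_int n * \<alpha>)) \<noteq> 1"
    proof
      assume "cos (2 * pi * (of_int n * \<alpha>)) = 1"
      then obtain k :: int where "2 * pi * (of_int n * \<alpha>) = of_int k * 2 * pi"
        by (auto simp: cos_one_2pi_int)
      then have "of_int n * \<alpha> = of_int k" by simp
      with irrational_multiple_not_int[OF \<alpha> that] show False by simp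
    qed
    with cos_le_one[of "2 * pi * (of_int n * \<alpha>)"] show ?thesis by linarith
  qed
  define C where "C = (\<Sum>n\<in>{-M..M} - {0}. wall 0 / (1 - cos (2 * pi * (of_int n * \<alpha>))))"
  have wall0: "0 < wall 0" by (simp add: wall_def)
  have C: "wall 0 / (1 - cos (2 * pi * (of_int n * \<alpha>))) \<le> C" if "n \<noteq> 0" "\<bar>n\<bar> \<le> M" for n
    unfolding C_def by (rule member_le_sum) (use that pos wall0 in \<open>auto simp: less_imp_le\<close>)
  have M: "1 \<le> M" by (simp add: M_def run_def)
  have C0: "0 \<le> C"
    unfolding C_def using pos wall0 by (intro sum_nonneg) (auto simp: less_imp_le)
  define v where "v x = 1 + C * (1 - cos (2 * pi * x))" for x
  have v1: "1 \<le> v x" for x using C0 by (simp add: v_def)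
  have big: "wall 0 \<le> v (of_int n * \<alpha>)" if n: "n \<noteq> 0" "\<bar>n\<bar> \<le> M" for n
    using C[OF n] pos[OF n(1)] by (simp add: v_def divide_le_eq)
  have cont: "continuous_on UNIV v" unfolding v_def by (intro continuous_intros)
  have per: "v (x + 1) = v x" for x by (simp add: v_def distrib_left)
  obtain H where H: "\<And>x. (H has_real_derivative v x) (at x)"
    using antiderivative_on_line[OF cont] by blast
  obtain s where s: "0 < s" "s \<le> rate 0" "\<bar>H s - H 0 - v 0 * s\<bar> \<le> rate 0 * s"
    "\<bar>H (\<alpha> + s) - H \<alpha> - v \<alpha> * s\<bar> \<le> rate 0 * s"
    using test_scale[OF H rate_pos rate_pos] by blast
  have "roomy (v \<alpha>) 0 (\<lambda>n. v (of_int n * \<alpha>))"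
    unfolding roomy_def
  proof (intro exI[of _ "\<lambda>n. v (of_int n * \<alpha>)"] exI[of _ 1] conjI allI impI)
    show "recip_sum (\<lambda>n. v (of_int n * \<alpha>)) 1 1 \<le> budget 0"
    proof -
      have "{-1..<1} = {-1, 0 :: int}" by auto
      then have "recip_sum (\<lambda>n. v (of_int n * \<alpha>)) 1 1 = 1 / v (of_int (-1) * \<alpha>) + 1 / v (of_int 1 * \<alpha>)"
        by (simp add: recip_sum_def v_def)
      also have "\<dots> \<le> 1 / wall 0 + 1 / wall 0"
        using big[of 1] big[of "-1"] M wall0 by (intro add_mono divide_left_mono mult_pos_pos) auto
      also have "\<dots> \<le> budget 0" by (simp add: wall_def budget_def)
      finally show ?thesis .
    qed
  qed (use big v1 in \<open>auto simp: v_def tilt_def M_def\<close>)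
  then have "stage \<alpha> (v \<alpha>) 0 (v, H, s)"
    using cont per H s less_le_trans[OF _ v1, of "1 / 2"] by (simp add: stage_def)
  then show ?thesis using v1 by (intro that)
qed

lemma stage_refine:
  assumes \<alpha>: "\<alpha> \<notin> \<rat>" and "stage \<alpha> \<rho> N st"
  shows "\<exists>st'. stage \<alpha> \<rho> (Suc N) st' \<and> refines \<alpha> N st st'"
proof -
  obtain v H s where st: "st = (v, H, s)" by (cases st) auto
  have v: "continuous_on UNIV v" "\<And>x. v (x + 1) = v x" "\<And>x. 1 / 2 < v x"
    and H: "\<And>x. (H has_real_derivative v x) (at x)"
    and room: "roomy \<rho> N (\<lambda>n. v (of_int n * \<alpha>))" and s: "0 < s"
    using assms(2) by (auto simp: st stage_def)
  obtain u R where u: "1 \<le> R" "\<And>n. 1 / 2 < u n" "\<And>n. R \<le> \<bar>n\<bar> \<Longrightarrow> u n = v (of_int n * \<alpha>)"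
    "\<And>n. close_up (3 / 4 * rate N) ((u (n + 1) + u (n - 1)) * v (of_int n * \<alpha>))
       ((v (of_int (n + 1) * \<alpha>) + v (of_int (n - 1) * \<alpha>)) * u n)"
    and room': "\<And>u'. (\<And>n. \<bar>n\<bar> \<le> R \<Longrightarrow> u' n = u n) \<Longrightarrow> roomy \<rho> (Suc N) u'"
    using room_transition[OF room v(3)] by metis
  have r: "3 / 4 * rate N < rate N" "0 \<le> rate N" "0 < rate N * s"
    using rate_pos[of N] s by auto
  obtain v' H' where v': "continuous_on UNIV v'" "\<And>x. v' (x + 1) = v' x" "\<And>x. 1 / 2 < v' x"
    and H': "\<And>x. (H' has_real_derivative v' x) (at x)"
    and v'u: "\<And>n. \<bar>n\<bar> \<le> R \<Longrightarrow> v' (of_int n * \<alpha>) = u n"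
    and near: "\<And>x. close_up (rate N) ((v' (x + \<alpha>) + v' (x - \<alpha>)) * v x) ((v (x + \<alpha>) + v (x - \<alpha>)) * v' x)"
    and inc: "\<And>x y. x \<le> y \<Longrightarrow> \<bar>(H' y - H' x) - (H y - H x)\<bar> \<le> rate N * s * (y - x + 1)"
    using perturb_along_orbit[OF \<alpha> v H u r] by metis
  have "0 < min s (rate (Suc N))" using s rate_pos by simp
  from test_scale[OF H' rate_pos[of "Suc N"] this]
  obtain s' where s': "0 < s'" "s' \<le> min s (rate (Suc N))"
    "\<bar>H' s' - H' 0 - v' 0 * s'\<bar> \<le> rate (Suc N) * s'"
    "\<bar>H' (\<alpha> + s') - H' \<alpha> - v' \<alpha> * s'\<bar> \<le> rate (Suc N) * s'"
    by blast
  have "stage \<alpha> \<rho> (Suc N) (v', H', s')"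
    using v' H' s' room'[of "\<lambda>n. v' (of_int n * \<alpha>)"] v'u by (simp add: stage_def)
  moreover have "refines \<alpha> N st (v', H', s')"
    using near inc s' by (simp add: st refines_def nbr_sum_def)
  ultimately show ?thesis by blast
qed

text \<open>
  The equation is the Wronskian of the reference solution, which takes the values \<open>1\<close> and \<open>\<rho>\<close> at \<open>0\<close> and
  \<open>1\<close>, and its tilted form. As \<open>v 0\<close> is bounded, the slope \<open>v 1 / v 0\<close> exceeds \<open>\<rho>\<close> by a definite amount at
  the odd stages and equals \<open>\<rho>\<close> at the even ones.
\<close>

lemma roomy_slope:
  assumes "roomy \<rho> N v" "1 \<le> \<rho>"
  shows "v 1 = \<rho> * v 0 + tilt N" "v 0 \<le> 3 / 2"
proof -
  obtain r L where L: "1 \<le> L" and r01: "r 0 = 1" "r 1 = \<rho>"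
    and vr: "\<And>n. \<bar>n\<bar> \<le> L + run (N + 1) \<Longrightarrow> v n = r n * (1 + tilt N * recip_sum r L n)"
    and r1: "\<And>n. \<bar>n\<bar> \<le> L \<Longrightarrow> 1 \<le> r n"
    and bud: "recip_sum r L L \<le> budget N"
    using assms(1) unfolding roomy_def by auto
  have "0 < run (N + 1)" by (simp add: run_def)
  then have v01: "v 0 = 1 + tilt N * recip_sum r L 0" "v 1 = \<rho> * (1 + tilt N * recip_sum r L 1)"
    using vr[of 0] vr[of 1] L r01 by simp_all
  moreover have "recip_sum r L 1 = recip_sum r L 0 + 1 / \<rho>"
    using recip_sum_step[of r L 0] L r01 by simp
  ultimately show "v 1 = \<rho> * v 0 + tilt N"
    using assms(2) by (simp add: distrib_left)
  have "0 < r n" if "\<bar>n\<bar> \<le> L" for n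
    using r1[OF that] by simp
  then have "recip_sum r L 0 \<le> recip_sum r L L"
    by (rule recip_sum_bounds(2))
  also have "budget N \<le> 1 / 2" by (simp add: budget_def)
  with bud have "recip_sum r L L \<le> 1 / 2" by simp
  finally have "recip_sum r L 0 \<le> 1 / 2" .
  then show "v 0 \<le> 3 / 2"
    unfolding v01 by (simp add: tilt_def)
qed

lemma geometric_limit:
  fixes f :: "nat \<Rightarrow> real"
  assumes "\<And>n. \<bar>f (Suc n) - f n\<bar> \<le> C * rate n"
  obtains l where "f \<longlonglongrightarrow> l" "\<And>n. \<bar>l - f n\<bar> \<le> 2 * C * rate n"
proof -
  have C: "0 \<le> C" using assms[of 0] by (simp add: rate_def)
  have step: "\<bar>f (n + k) - f n\<bar> \<le> 2 * C * rate n - 2 * C * rate (n + k)" for n k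
  proof (induction k)
    case (Suc k)
    then show ?case using assms[of "n + k"] by (simp add: rate_Suc)
  qed simp
  have tail: "\<bar>f (n + k) - f n\<bar> \<le> 2 * C * rate n" for n k
    using step[of n k] mult_nonneg_nonneg[OF C less_imp_le[OF rate_pos[of "n + k"]]] by simp
  have "Cauchy f"
  proof (rule CauchyI')
    fix e :: real assume "0 < e"
    have "(\<lambda>n. 2 * C * rate n) \<longlonglongrightarrow> 2 * C * 0"
      by (intro tendsto_intros rate_tendsto)
    then have "\<forall>\<^sub>F n in sequentially. 2 * C * rate n < e"
      using \<open>0 < e\<close> by (auto dest: order_tendstoD)
    then obtain M where M: "\<And>n. M \<le> n \<Longrightarrow> 2 * C * rate n < e"
      by (auto simp: eventually_sequentially)
    show "\<exists>M. \<forall>m\<ge>M. \<forall>n>m. dist (f m) (f n) < e"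
    proof (intro exI allI impI)
      fix m n assume "M \<le> m" "m < n"
      then show "dist (f m) (f n) < e"
        using M[of m] tail[of m "n - m"] by (simp add: dist_real_def abs_minus_commute)
    qed
  qed
  then obtain l where l: "f \<longlonglongrightarrow> l" by (auto simp: Cauchy_convergent_iff convergent_def)
  have "\<bar>l - f n\<bar> \<le> 2 * C * rate n" for n
  proof (rule LIMSEQ_le_const2)
    show "(\<lambda>k. \<bar>f (k + n) - f n\<bar>) \<longlonglongrightarrow> \<bar>l - f n\<bar>"
      by (intro tendsto_intros LIMSEQ_ignore_initial_segment l)
    show "\<exists>N. \<forall>k\<ge>N. \<bar>f (k + n) - f n\<bar> \<le> 2 * C * rate n"
      using tail[of n] by (auto simp: add.commute)
  qed
  with l show ?thesis by (rule that)
qed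


text \<open>
  If \<open>X / Y\<close> had a limit \<open>D\<close>, then \<open>(D - \<rho>) Y - tilt\<close> would tend to \<open>0\<close>. The even terms force \<open>D = \<rho>\<close>, and
  then the odd terms are \<open>-1\<close>.
\<close>

lemma alternating_ratio_diverges:
  fixes X Y :: "nat \<Rightarrow> real"
  assumes lim: "(\<lambda>n. X n - \<rho> * Y n - tilt n) \<longlonglongrightarrow> 0" and Y: "\<And>n. 1 / 2 \<le> Y n" "\<And>n. Y n \<le> B"
  shows "\<not> convergent (\<lambda>n. X n / Y n)"
proof
  assume "convergent (\<lambda>n. X n / Y n)"
  then obtain D where D: "(\<lambda>n. X n / Y n) \<longlonglongrightarrow> D" by (auto simp: convergent_def)
  have "(\<lambda>n. X n - D * Y n) \<longlonglongrightarrow> 0"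
  proof (rule Lim_null_comparison)
    have "\<bar>X n - D * Y n\<bar> \<le> B * \<bar>X n / Y n - D\<bar>" for n
    proof -
      have "X n - D * Y n = Y n * (X n / Y n - D)"
        using Y(1)[of n] by (simp add: field_simps)
      then have "\<bar>X n - D * Y n\<bar> = Y n * \<bar>X n / Y n - D\<bar>"
        using Y(1)[of n] by (simp add: abs_mult)
      also have "\<dots> \<le> B * \<bar>X n / Y n - D\<bar>"
        using Y(2)[of n] by (rule mult_right_mono) simp
      finally show ?thesis .
    qed
    then show "\<forall>\<^sub>F n in sequentially. norm (X n - D * Y n) \<le> B * \<bar>X n / Y n - D\<bar>" by simp
    have "(\<lambda>n. B * \<bar>X n / Y n - D\<bar>) \<longlonglongrightarrow> B * \<bar>D - D\<bar>"
      by (intro tendsto_intros D)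
    then show "(\<lambda>n. B * \<bar>X n / Y n - D\<bar>) \<longlonglongrightarrow> 0" by simp
  qed
  from tendsto_diff[OF lim this] have Z: "(\<lambda>n. (D - \<rho>) * Y n - tilt n) \<longlonglongrightarrow> 0"
    by (simp add: algebra_simps)
  have "strict_mono (\<lambda>n::nat. 2 * n)" "strict_mono (\<lambda>n::nat. Suc (2 * n))"
    by (auto simp: strict_mono_def)
  from this[THEN LIMSEQ_subseq_LIMSEQ[OF Z]]
  have even: "(\<lambda>n. (D - \<rho>) * Y (2 * n)) \<longlonglongrightarrow> 0"
    and odd: "(\<lambda>n. (D - \<rho>) * Y (Suc (2 * n)) - 1) \<longlonglongrightarrow> 0"
    by (simp_all add: tilt_def comp_def)
  have "\<bar>D - \<rho>\<bar> * (1 / 2) \<le> 0"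
  proof (rule LIMSEQ_le_const)
    show "(\<lambda>n. \<bar>(D - \<rho>) * Y (2 * n)\<bar>) \<longlonglongrightarrow> 0" using tendsto_rabs[OF even] by simp
    have "\<bar>D - \<rho>\<bar> * (1 / 2) \<le> \<bar>(D - \<rho>) * Y (2 * n)\<bar>" for n
      using Y(1)[of "2 * n"] unfolding abs_mult by (intro mult_left_mono) auto
    then show "\<exists>N. \<forall>n\<ge>N. \<bar>D - \<rho>\<bar> * (1 / 2) \<le> \<bar>(D - \<rho>) * Y (2 * n)\<bar>" by blast
  qed
  then have "D = \<rho>" by simp
  with odd show False by (simp add: LIMSEQ_const_iff)
qed

lemma close_up_cross:
  assumes "close_up r (a * v) (b * v')" "0 < v" "0 < v'"
  shows "close_up r (a / v') (b / v)"
proof -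
  have "a * v / (v * v') \<le> exp r * (b * v') / (v * v')" "b * v' / (v * v') \<le> exp r * (a * v) / (v * v')"
    using assms by (intro divide_right_mono close_upD; simp)+
  then show ?thesis using assms(2,3) by (simp add: close_up_def)
qed

lemma close_up_ln:
  assumes "close_up r x y" "0 < x" "0 < y"
  shows "\<bar>ln x - ln y\<bar> \<le> r"
proof -
  have "ln x \<le> ln (exp r * y)" "ln y \<le> ln (exp r * x)"
    using assms by (auto simp: close_up_def intro!: ln_mono)
  moreover have "ln (exp r * y) = r + ln y" "ln (exp r * x) = r + ln x"
    using assms by (simp_all add: ln_mult)
  ultimately show ?thesis by linarith
qed

text \<open>
  This expresses \<open>d\<Phi> = c dG\<close> without integrals, in a form that passes to pointwise limits of \<open>G\<close> and \<open>\<Phi>\<close>.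
\<close>

definition stieltjes_density :: "(real \<Rightarrow> real) \<Rightarrow> (real \<Rightarrow> real) \<Rightarrow> (real \<Rightarrow> real) \<Rightarrow> bool" where
  "stieltjes_density c G \<Phi> \<longleftrightarrow> (\<forall>x y l. x \<le> y \<longrightarrow>
     ((\<forall>t\<in>{x..y}. l \<le> c t) \<longrightarrow> l * (G y - G x) \<le> \<Phi> y - \<Phi> x) \<and>
     ((\<forall>t\<in>{x..y}. c t \<le> l) \<longrightarrow> \<Phi> y - \<Phi> x \<le> l * (G y - G x)))"

text \<open>
  The logarithms of the functions \<open>c\<close> converge uniformly because consecutive ones differ by at most
  \<open>rate n\<close>. At every stage \<open>c\<close> is the density of \<open>nbr_sum \<alpha> H\<close> with respect to \<open>H\<close> by monotonicity, and this
  survives in the limit even where \<open>G\<close> has no derivative. The increments of \<open>G\<close> at the scale \<open>s n\<close>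
  differ from those of stage \<open>n\<close> by \<open>O(rate n * s n)\<close>, so its slopes there follow the alternating
  slopes of the stages.
\<close>

lemma limit_of_stages:
  assumes \<alpha>: "\<alpha> \<notin> \<rat>"
  obtains G c :: "real \<Rightarrow> real" and I and s :: "nat \<Rightarrow> real" where
    "continuous_on UNIV G" "continuous_on UNIV c"
    "\<And>x. G (x + 1) = G x + I"
    "\<And>x y. x \<le> y \<Longrightarrow> (y - x) / 2 \<le> G y - G x"
    "stieltjes_density c G (nbr_sum \<alpha> G)"
    "\<And>n. 0 < s n" "s \<longlonglongrightarrow> 0"
    "\<not> convergent (\<lambda>n. (G (\<alpha> + s n) - G \<alpha>) / (G (s n) - G 0))"
proof -
  obtain \<rho> st0 where \<rho>: "1 \<le> \<rho>" and st0: "stage \<alpha> \<rho> 0 st0"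
    using stage_zero[OF \<alpha>] by blast
  have "\<exists>F. \<forall>n. stage \<alpha> \<rho> n (F n) \<and> refines \<alpha> n (F n) (F (Suc n))"
    by (rule dependent_nat_choice) (use st0 stage_refine[OF \<alpha>] in blast)+
  then obtain F where F: "\<And>n. stage \<alpha> \<rho> n (F n)" "\<And>n. refines \<alpha> n (F n) (F (Suc n))"
    by blast
  define v H s where "v n = fst (F n)" and "H n = fst (snd (F n))" and "s n = snd (snd (F n))" for n
  have Fn: "F n = (v n, H n, s n)" for n by (simp add: v_def H_def s_def)
  have v: "continuous_on UNIV (v n)" "v n (x + 1) = v n x" "1 / 2 < v n x"
    and H: "(H n has_real_derivative v n x) (at x)"
    and room: "roomy \<rho> n (\<lambda>k. v n (of_int k * \<alpha>))"
    and s: "0 < s n" "s n \<le> rate n"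
    and test: "\<bar>H n (s n) - H n 0 - v n 0 * s n\<bar> \<le> rate n * s n"
      "\<bar>H n (\<alpha> + s n) - H n \<alpha> - v n \<alpha> * s n\<bar> \<le> rate n * s n" for n x
    using F(1)[of n] by (simp_all add: Fn stage_def)
  have near: "close_up (rate n) (nbr_sum \<alpha> (v (Suc n)) x * v n x) (nbr_sum \<alpha> (v n) x * v (Suc n) x)"
    and inc: "x \<le> y \<Longrightarrow> \<bar>(H (Suc n) y - H (Suc n) x) - (H n y - H n x)\<bar> \<le> rate n * s n * (y - x + 1)"
    and s_Suc: "s (Suc n) \<le> s n" for n x y
    using F(2)[of n] by (simp_all add: Fn refines_def)
  have s_dec: "s (n + k) \<le> s n" for n k
    by (induction k) (use s_Suc in \<open>auto intro: order_trans\<close>)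
  have "\<exists>l. (\<lambda>n. H n x - H n 0) \<longlonglongrightarrow> l" for x
  proof -
    have "\<bar>(H (Suc n) x - H (Suc n) 0) - (H n x - H n 0)\<bar> \<le> (\<bar>x\<bar> + 1) * rate n" for n
    proof -
      have "\<bar>(H (Suc n) x - H (Suc n) 0) - (H n x - H n 0)\<bar> \<le> rate n * s n * (\<bar>x\<bar> + 1)"
      proof (cases "0 \<le> x")
        case True
        then show ?thesis using inc[of 0 x n] by simp
      next
        case False
        then have "\<bar>(H (Suc n) 0 - H (Suc n) x) - (H n 0 - H n x)\<bar> \<le> rate n * s n * (\<bar>x\<bar> + 1)"
          using inc[of x 0 n] by simp
        then show ?thesis by linarith
      qed
      also have "rate n * s n \<le> rate n * 1"
        using s[of n] rate_le_one[of n] rate_pos[of n] by (intro mult_left_mono) auto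
      then have "rate n * s n * (\<bar>x\<bar> + 1) \<le> rate n * 1 * (\<bar>x\<bar> + 1)"
        by (rule mult_right_mono) simp
      finally show ?thesis by (simp add: mult.commute)
    qed
    from geometric_limit[OF this] show ?thesis by metis
  qed
  then obtain G where G: "\<And>x. (\<lambda>n. H n x - H n 0) \<longlonglongrightarrow> G x"
    by metis
  have G_inc: "(\<lambda>n. H n y - H n x) \<longlonglongrightarrow> G y - G x" for x y
    using tendsto_diff[OF G[of y] G[of x]] by simp
  have tail: "\<bar>(G y - G x) - (H n y - H n x)\<bar> \<le> 2 * rate n * s n * (y - x + 1)" if "x \<le> y" for x y n
  proof -
    have "\<bar>(H (n + Suc k) y - H (n + Suc k) x) - (H (n + k) y - H (n + k) x)\<bar>
        \<le> (rate n * s n * (y - x + 1)) * rate k" for k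
    proof -
      have "rate (n + k) * s (n + k) * (y - x + 1) \<le> rate (n + k) * s n * (y - x + 1)"
        using that s_dec[of n k] rate_pos[of "n + k"] by (intro mult_left_mono mult_right_mono) auto
      also have "\<dots> = (rate n * s n * (y - x + 1)) * rate k"
        by (simp add: rate_def power_add)
      finally show ?thesis using inc[OF that, of "n + k"] unfolding add_Suc_right by (rule order_trans[rotated])
    qed
    then obtain l where l: "(\<lambda>k. H (n + k) y - H (n + k) x) \<longlonglongrightarrow> l"
      "\<And>k. \<bar>l - (H (n + k) y - H (n + k) x)\<bar> \<le> 2 * (rate n * s n * (y - x + 1)) * rate k"
      by (rule geometric_limit[of "\<lambda>k. H (n + k) y - H (n + k) x"]) (rule that)
    have "(\<lambda>k. H (n + k) y - H (n + k) x) \<longlonglongrightarrow> G y - G x"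
      using LIMSEQ_ignore_initial_segment[OF G_inc[of y x], of n] by (simp add: add.commute)
    then have "l = G y - G x" by (rule LIMSEQ_unique[OF l(1)])
    then show ?thesis using l(2)[of 0] by (simp add: rate_def)
  qed
  have H_inc: "(y - x) / 2 \<le> H n y - H n x" if "x \<le> y" for x y n
  proof -
    have "H n x - x / 2 \<le> H n y - y / 2"
    proof (rule DERIV_nonneg_imp_nondecreasing[OF that])
      fix t
      show "\<exists>d. ((\<lambda>t. H n t - t / 2) has_real_derivative d) (at t) \<and> 0 \<le> d"
        using v(3)[of n t] by (intro exI[of _ "v n t - 1 / 2"]) (auto intro!: derivative_eq_intros H)
    qed
    then show ?thesis by (simp add: diff_divide_distrib)
  qed
  have low: "(y - x) / 2 \<le> G y - G x" if "x \<le> y" for x y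
    by (rule LIMSEQ_le_const[OF G_inc]) (use H_inc[OF that] in blast)
  have per: "G (x + 1) = G x + (G 1 - G 0)" for x
  proof -
    have "H n (x + 1) - H n x = H n 1 - H n 0" for n
      using periodic_derivative_quasi_periodic[of "H n" "v n" x, OF H v(2)] by simp
    then have "(\<lambda>n. H n (x + 1) - H n x) = (\<lambda>n. H n 1 - H n 0)" by (rule ext)
    then have "G (x + 1) - G x = G 1 - G 0"
      using G_inc[of "x + 1" x] G_inc[of 1 0] LIMSEQ_unique by metis
    then show ?thesis by simp
  qed
  have close: "\<bar>(G y - G x) - (H n y - H n x)\<bar> \<le> 4 * rate n" if "\<bar>y - x\<bar> \<le> 1" for x y n
  proof -
    have *: "\<bar>(G y - G x) - (H n y - H n x)\<bar> \<le> 4 * rate n" if "x \<le> y" "y - x \<le> 1" for x y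
    proof -
      have "2 * rate n * s n * (y - x + 1) \<le> 2 * rate n * 1 * 2"
        using that s[of n] rate_le_one[of n] rate_pos[of n] by (intro mult_mono) auto
      then show ?thesis using tail[OF that(1), of n] by simp
    qed
    show ?thesis
    proof (cases "x \<le> y")
      case False
      then have "\<bar>(G x - G y) - (H n x - H n y)\<bar> \<le> 4 * rate n"
        using that by (intro *) auto
      then show ?thesis by linarith
    qed (use * that in auto)
  qed
  have contG: "continuous_on UNIV G"
    unfolding continuous_on_iff
  proof (intro ballI allI impI)
    fix x e :: real assume "0 < e"
    then have "\<forall>\<^sub>F n in sequentially. rate n < e / 8"
      using rate_tendsto by (intro order_tendstoD(2)) auto
    then obtain n where n: "rate n < e / 8" by (auto simp: eventually_sequentially)
    have "isCont (H n) x" using H by (rule DERIV_isCont)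
    then obtain d where d: "0 < d" "\<And>y. \<bar>y - x\<bar> < d \<Longrightarrow> \<bar>H n y - H n x\<bar> < e / 2"
      using \<open>0 < e\<close> unfolding continuous_at_eps_delta by (metis dist_real_def half_gt_zero)
    show "\<exists>d>0. \<forall>y\<in>UNIV. dist y x < d \<longrightarrow> dist (G y) (G x) < e"
    proof (intro exI[of _ "min d 1"] conjI ballI impI)
      fix y assume "dist y x < min d 1"
      then have "\<bar>y - x\<bar> < d" "\<bar>y - x\<bar> \<le> 1" by (auto simp: dist_real_def)
      then show "dist (G y) (G x) < e"
        using d(2)[of y] close[of y x n] n unfolding dist_real_def by linarith
    qed (use d in auto)
  qed
  have vpos: "0 < v n x" for n x using v(3)[of n x] by simp
  have npos: "0 < nbr_sum \<alpha> (v n) x" for n x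
    unfolding nbr_sum_def by (intro add_pos_pos vpos)
  define lc where "lc n x = ln (nbr_sum \<alpha> (v n) x / v n x)" for n x
  have "\<exists>l. \<forall>n. \<bar>l - lc n x\<bar> \<le> 2 * rate n" for x
  proof -
    have "\<bar>lc (Suc n) x - lc n x\<bar> \<le> 1 * rate n" for n
    proof -
      have "close_up (rate n) (nbr_sum \<alpha> (v (Suc n)) x / v (Suc n) x) (nbr_sum \<alpha> (v n) x / v n x)"
        by (rule close_up_cross) (rule near vpos)+
      from close_up_ln[OF this] show ?thesis
        unfolding lc_def mult_1 by (simp only: divide_pos_pos npos vpos)
    qed
    then obtain l where "(\<lambda>n. lc n x) \<longlonglongrightarrow> l" "\<And>n. \<bar>l - lc n x\<bar> \<le> 2 * 1 * rate n"
      by (rule geometric_limit[of "\<lambda>n. lc n x"]) (rule that)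
    then show ?thesis by auto
  qed
  then obtain lc' where lc': "\<And>x n. \<bar>lc' x - lc n x\<bar> \<le> 2 * rate n" by metis
  have cont_lc: "continuous_on UNIV lc'"
  proof (rule uniform_limit_theorem)
    show "\<forall>\<^sub>F n in sequentially. continuous_on UNIV (lc n)"
    proof (rule always_eventually, rule allI)
      fix n
      have "continuous_on UNIV (\<lambda>x. v n (x + c))" for c
        by (rule continuous_on_compose2[OF v(1)]) (auto intro!: continuous_intros)
      from this[of \<alpha>] this[of "- \<alpha>"] show "continuous_on UNIV (lc n)"
        unfolding lc_def nbr_sum_def using npos[of n, unfolded nbr_sum_def] vpos[of n]
        by (intro continuous_intros v(1)) (auto simp: less_le)
    qed
    show "uniform_limit UNIV lc lc' sequentially"
    proof (rule uniform_limitI)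
      fix e :: real assume "0 < e"
      then have "\<forall>\<^sub>F n in sequentially. rate n < e / 2"
        using rate_tendsto by (intro order_tendstoD(2)) auto
      then show "\<forall>\<^sub>F n in sequentially. \<forall>x\<in>UNIV. dist (lc n x) (lc' x) < e"
      proof eventually_elim
        case (elim n)
        show ?case
        proof
          fix x show "dist (lc n x) (lc' x) < e"
            using lc'[of x n] elim unfolding dist_real_def by linarith
        qed
      qed
    qed
  qed simp
  define c where "c x = exp (lc' x)" for x
  have cont_c: "continuous_on UNIV c" unfolding c_def by (intro continuous_intros cont_lc)
  have c_near: "nbr_sum \<alpha> (v n) x \<le> exp (2 * rate n) * (c x * v n x)"
    "c x * v n x \<le> exp (2 * rate n) * nbr_sum \<alpha> (v n) x" for n x
  proof -
    have q: "nbr_sum \<alpha> (v n) x = exp (lc n x) * v n x"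
      using vpos[of n x] npos[of n x] by (simp add: lc_def)
    have "exp (lc n x) \<le> exp (2 * rate n + lc' x)" "exp (lc' x) \<le> exp (2 * rate n + lc n x)"
      using lc'[of x n] by (auto simp: abs_le_iff)
    from this[THEN mult_right_mono, of "v n x"] vpos[of n x]
    show "nbr_sum \<alpha> (v n) x \<le> exp (2 * rate n) * (c x * v n x)"
      "c x * v n x \<le> exp (2 * rate n) * nbr_sum \<alpha> (v n) x"
      unfolding q c_def by (simp_all add: exp_add)
  qed
  have HD: "(nbr_sum \<alpha> (H n) has_real_derivative nbr_sum \<alpha> (v n) x) (at x)" for n x
  proof -
    have "((\<lambda>x. H n (x + a)) has_real_derivative v n (x + a)) (at x)" for a
      using H[of n "x + a"] by (simp add: DERIV_shift)
    from DERIV_add[OF this[of \<alpha>] this[of "- \<alpha>"]] show ?thesis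
      unfolding nbr_sum_def by simp
  qed
  have exp_lim: "(\<lambda>n. exp (2 * rate n)) \<longlonglongrightarrow> 1" "(\<lambda>n. exp (- (2 * rate n))) \<longlonglongrightarrow> 1"
  proof -
    have "(\<lambda>n. exp (2 * rate n)) \<longlonglongrightarrow> exp (2 * 0)" "(\<lambda>n. exp (- (2 * rate n))) \<longlonglongrightarrow> exp (- (2 * 0))"
      by (intro tendsto_intros rate_tendsto)+
    then show "(\<lambda>n. exp (2 * rate n)) \<longlonglongrightarrow> 1" "(\<lambda>n. exp (- (2 * rate n))) \<longlonglongrightarrow> 1" by simp_all
  qed
  have N_inc: "(\<lambda>n. nbr_sum \<alpha> (H n) y - nbr_sum \<alpha> (H n) x) \<longlonglongrightarrow> nbr_sum \<alpha> G y - nbr_sum \<alpha> G x" for x y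
    using tendsto_add[OF G_inc[of "y + \<alpha>" "x + \<alpha>"] G_inc[of "y - \<alpha>" "x - \<alpha>"]]
    by (simp add: nbr_sum_def algebra_simps)
  have lower: "l * (G y - G x) \<le> nbr_sum \<alpha> G y - nbr_sum \<alpha> G x"
    if xy: "x \<le> y" and l: "\<And>t. x \<le> t \<Longrightarrow> t \<le> y \<Longrightarrow> l \<le> c t" for x y l
  proof (rule LIMSEQ_le)
    show "(\<lambda>n. 1 * l * (H n y - H n x)) \<longlonglongrightarrow> l * (G y - G x)"
      using tendsto_mult_left[OF G_inc, of l] by simp
    show "(\<lambda>n. exp (2 * rate n) * (nbr_sum \<alpha> (H n) y - nbr_sum \<alpha> (H n) x))
        \<longlonglongrightarrow> nbr_sum \<alpha> G y - nbr_sum \<alpha> G x"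
      using tendsto_mult[OF exp_lim(1) N_inc] by simp
    have "exp (2 * rate n) * nbr_sum \<alpha> (H n) x - l * H n x
        \<le> exp (2 * rate n) * nbr_sum \<alpha> (H n) y - l * H n y" for n
    proof (rule DERIV_nonneg_imp_nondecreasing[OF xy])
      fix t assume t: "x \<le> t" "t \<le> y"
      have "l * v n t \<le> c t * v n t" using l[OF t] vpos[of n t] by simp
      with c_near(2)[of t n]
      have "0 \<le> exp (2 * rate n) * nbr_sum \<alpha> (v n) t - l * v n t" by linarith
      moreover have "((\<lambda>t. exp (2 * rate n) * nbr_sum \<alpha> (H n) t - l * H n t)
          has_real_derivative exp (2 * rate n) * nbr_sum \<alpha> (v n) t - l * v n t) (at t)"
        by (intro DERIV_diff DERIV_cmult HD H)
      ultimately show "\<exists>d. ((\<lambda>t. exp (2 * rate n) * nbr_sum \<alpha> (H n) t - l * H n t)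
          has_real_derivative d) (at t) \<and> 0 \<le> d" by blast
    qed
    then show "\<exists>N. \<forall>n\<ge>N. 1 * l * (H n y - H n x) \<le> exp (2 * rate n) * (nbr_sum \<alpha> (H n) y - nbr_sum \<alpha> (H n) x)"
      unfolding mult_1 right_diff_distrib by (intro exI[of _ 0] allI impI) (smt (verit))
  qed
  have upper: "nbr_sum \<alpha> G y - nbr_sum \<alpha> G x \<le> l * (G y - G x)"
    if xy: "x \<le> y" and l: "\<And>t. x \<le> t \<Longrightarrow> t \<le> y \<Longrightarrow> c t \<le> l" for x y l
  proof (rule LIMSEQ_le)
    show "(\<lambda>n. exp (2 * rate n) * l * (H n y - H n x)) \<longlonglongrightarrow> l * (G y - G x)"
      using tendsto_mult[OF exp_lim(1) tendsto_mult_left[OF G_inc, of l]] by (simp add: mult.assoc)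
    show "(\<lambda>n. nbr_sum \<alpha> (H n) y - nbr_sum \<alpha> (H n) x) \<longlonglongrightarrow> nbr_sum \<alpha> G y - nbr_sum \<alpha> G x"
      by (rule N_inc)
    have "exp (2 * rate n) * l * H n x - nbr_sum \<alpha> (H n) x
        \<le> exp (2 * rate n) * l * H n y - nbr_sum \<alpha> (H n) y" for n
    proof (rule DERIV_nonneg_imp_nondecreasing[OF xy])
      fix t assume t: "x \<le> t" "t \<le> y"
      have "exp (2 * rate n) * (c t * v n t) \<le> exp (2 * rate n) * (l * v n t)"
        using l[OF t] vpos[of n t] by (intro mult_left_mono mult_right_mono) auto
      from order_trans[OF c_near(1) this]
      have "0 \<le> exp (2 * rate n) * l * v n t - nbr_sum \<alpha> (v n) t" by (simp add: mult.assoc)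
      moreover have "((\<lambda>t. exp (2 * rate n) * l * H n t - nbr_sum \<alpha> (H n) t)
          has_real_derivative exp (2 * rate n) * l * v n t - nbr_sum \<alpha> (v n) t) (at t)"
        by (intro DERIV_diff DERIV_cmult HD H)
      ultimately show "\<exists>d. ((\<lambda>t. exp (2 * rate n) * l * H n t - nbr_sum \<alpha> (H n) t)
          has_real_derivative d) (at t) \<and> 0 \<le> d" by blast
    qed
    then show "\<exists>N. \<forall>n\<ge>N. nbr_sum \<alpha> (H n) y - nbr_sum \<alpha> (H n) x \<le> exp (2 * rate n) * l * (H n y - H n x)"
      unfolding mult_1 right_diff_distrib by (intro exI[of _ 0] allI impI) (smt (verit))
  qed
  have slope: "\<bar>(G (a + s n) - G a) / s n - v n a\<bar> \<le> 5 * rate n"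
    if t: "\<bar>H n (a + s n) - H n a - v n a * s n\<bar> \<le> rate n * s n" for a n
  proof -
    have "2 * rate n * s n * (s n + 1) \<le> 2 * rate n * s n * 2"
      using s[of n] rate_pos[of n] rate_le_one[of n] by (intro mult_left_mono) auto
    with tail[of a "a + s n" n] t s(1)[of n]
    have "\<bar>(G (a + s n) - G a) - v n a * s n\<bar> \<le> 5 * (rate n * s n)"
      by (simp add: mult.assoc)
    moreover have "(G (a + s n) - G a) / s n - v n a = ((G (a + s n) - G a) - v n a * s n) / s n"
      using s(1)[of n] by (simp add: field_simps)
    ultimately show ?thesis
      using s(1)[of n] by (simp add: divide_le_eq mult.assoc)
  qed
  have s0: "\<bar>(G (s n) - G 0) / s n - v n 0\<bar> \<le> 5 * rate n"
    and s\<alpha>: "\<bar>(G (\<alpha> + s n) - G \<alpha>) / s n - v n \<alpha>\<bar> \<le> 5 * rate n" for n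
    using slope[of n 0] slope[of n \<alpha>] test[of n] by simp_all
  have v\<alpha>: "v n \<alpha> = \<rho> * v n 0 + tilt n" "v n 0 \<le> 3 / 2" for n
    using roomy_slope[OF room \<rho>, of n] by simp_all
  have asymp: "(\<lambda>n. (G (\<alpha> + s n) - G \<alpha>) / s n - \<rho> * ((G (s n) - G 0) / s n) - tilt n) \<longlonglongrightarrow> 0"
  proof (rule Lim_null_comparison)
    have "\<bar>(G (\<alpha> + s n) - G \<alpha>) / s n - \<rho> * ((G (s n) - G 0) / s n) - tilt n\<bar>
        \<le> (5 + 5 * \<rho>) * rate n" for n
    proof -
      have "(G (\<alpha> + s n) - G \<alpha>) / s n - \<rho> * ((G (s n) - G 0) / s n) - tilt n =
        ((G (\<alpha> + s n) - G \<alpha>) / s n - v n \<alpha>) - \<rho> * ((G (s n) - G 0) / s n - v n 0)"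
        using v\<alpha>(1)[of n] by (simp add: right_diff_distrib)
      also have "\<bar>\<dots>\<bar> \<le> 5 * rate n + \<rho> * (5 * rate n)"
      proof (rule order_trans[OF abs_triangle_ineq4 add_mono])
        show "\<bar>\<rho> * ((G (s n) - G 0) / s n - v n 0)\<bar> \<le> \<rho> * (5 * rate n)"
          using \<rho> s0[of n] unfolding abs_mult by (intro mult_mono) auto
      qed (rule s\<alpha>)
      finally show ?thesis by (simp add: algebra_simps)
    qed
    then show "\<forall>\<^sub>F n in sequentially. norm ((G (\<alpha> + s n) - G \<alpha>) / s n - \<rho> * ((G (s n) - G 0) / s n) - tilt n)
        \<le> (5 + 5 * \<rho>) * rate n" by simp
    show "(\<lambda>n. (5 + 5 * \<rho>) * rate n) \<longlonglongrightarrow> 0"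
      using tendsto_mult_left[OF rate_tendsto, of "5 + 5 * \<rho>"] by simp
  qed
  have "\<not> convergent (\<lambda>n. ((G (\<alpha> + s n) - G \<alpha>) / s n) / ((G (s n) - G 0) / s n))"
  proof (rule alternating_ratio_diverges[OF asymp])
    show "1 / 2 \<le> (G (s n) - G 0) / s n" for n
      using low[of 0 "s n"] s(1)[of n] by (simp add: le_divide_eq)
    show "(G (s n) - G 0) / s n \<le> 7" for n
      using s0[of n] v\<alpha>(2)[of n] rate_le_one[of n] by linarith
  qed
  moreover have "((G (\<alpha> + s n) - G \<alpha>) / s n) / ((G (s n) - G 0) / s n)
      = (G (\<alpha> + s n) - G \<alpha>) / (G (s n) - G 0)" for n
    using s(1)[of n] by simp
  ultimately have div: "\<not> convergent (\<lambda>n. (G (\<alpha> + s n) - G \<alpha>) / (G (s n) - G 0))"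
    by (simp only: not_False_eq_True)
  have "s \<longlonglongrightarrow> 0"
    by (rule tendsto_sandwich[OF _ _ tendsto_const rate_tendsto]) (use s in \<open>auto simp: less_imp_le\<close>)
  moreover have "stieltjes_density c G (nbr_sum \<alpha> G)"
    unfolding stieltjes_density_def using lower upper by simp
  ultimately show ?thesis
    using that[OF contG cont_c per low _ s(1) _ div] by blast
qed

section \<open>The circle homeomorphism\<close>

lemma expanding_homeomorphism:
  fixes G :: "real \<Rightarrow> real"
  assumes "0 < \<kappa>" and low: "\<And>x y. x \<le> y \<Longrightarrow> \<kappa> * (y - x) \<le> G y - G x" and cont: "continuous_on UNIV G"
  shows "strict_mono G" "bij G" "continuous_on UNIV (inv G)" "\<And>x y. \<kappa> * \<bar>y - x\<bar> \<le> \<bar>G y - G x\<bar>"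
proof -
  show sm: "strict_mono G"
  proof
    fix x y :: real assume "x < y"
    then show "G x < G y" using low[of x y] mult_pos_pos[OF assms(1), of "y - x"] by simp
  qed
  show exp: "\<kappa> * \<bar>y - x\<bar> \<le> \<bar>G y - G x\<bar>" for x y
    using low[of x y] low[of y x] by (cases "x \<le> y") auto
  have "\<exists>x. G x = z" for z
  proof -
    define b where "b = \<bar>z - G 0\<bar> / \<kappa>"
    have b: "0 \<le> b" "\<kappa> * b = \<bar>z - G 0\<bar>" using assms(1) by (simp_all add: b_def)
    have "G (- b) \<le> z" "z \<le> G b" using low[of "- b" 0] low[of 0 b] b by auto
    then show ?thesis
      using IVT'[of G "- b" z b] b(1) continuous_on_subset[OF cont] by auto
  qed
  then have "surj G" by (metis surjI surj_def)
  with sm show "bij G" by (simp add: bij_def strict_mono_imp_inj_on)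
  show "continuous_on UNIV (inv G)"
    unfolding continuous_on_iff
  proof (intro ballI allI impI)
    fix z e :: real assume "0 < e"
    show "\<exists>d>0. \<forall>w\<in>UNIV. dist w z < d \<longrightarrow> dist (inv G w) (inv G z) < e"
    proof (intro exI[of _ "\<kappa> * e"] conjI ballI impI)
      fix w assume "dist w z < \<kappa> * e"
      then have "\<kappa> * \<bar>inv G w - inv G z\<bar> < \<kappa> * e"
        using exp[of "inv G w" "inv G z"] \<open>surj G\<close> by (simp add: surj_f_inv_f dist_real_def)
      then show "dist (inv G w) (inv G z) < e"
        using assms(1) by (simp add: dist_real_def)
    qed (use assms \<open>0 < e\<close> in simp)
  qed
qed

text \<open>
  Near \<open>x\<close> the density \<open>c\<close> is within \<open>e\<close> of \<open>c x\<close>, so the increments of \<open>\<Phi>\<close> are \<open>c x\<close> times those of \<open>G\<close>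
  up to an error of at most \<open>e\<close> times the latter. The expansion of \<open>G\<close> guarantees that points near \<open>G x\<close> come from points near
  \<open>x\<close>.
\<close>

lemma stieltjes_chain_derivative:
  fixes G \<Phi> \<psi> c :: "real \<Rightarrow> real"
  assumes "0 < \<kappa>" and low: "\<And>x y. x \<le> y \<Longrightarrow> \<kappa> * (y - x) \<le> G y - G x" and "surj G"
    and c: "continuous_on UNIV c"
    and dens: "stieltjes_density c G \<Phi>"
    and \<psi>: "\<And>x. \<psi> (G x) = \<Phi> x"
  shows "(\<psi> has_real_derivative c x) (at (G x))"
  unfolding has_field_derivative_def has_derivative_at_alt
proof (intro conjI allI impI)
  fix e :: real assume "0 < e"
  then obtain d where d: "0 < d" "\<And>t. \<bar>t - x\<bar> < d \<Longrightarrow> \<bar>c t - c x\<bar> < e"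
    using c unfolding continuous_on_iff by (metis UNIV_I dist_real_def)
  have key: "\<bar>\<Phi> b - \<Phi> a - c x * (G b - G a)\<bar> \<le> e * (G b - G a)"
    if ab: "a \<le> b" "\<bar>a - x\<bar> < d" "\<bar>b - x\<bar> < d" for a b
  proof -
    have "\<bar>t - x\<bar> < d" if "a \<le> t" "t \<le> b" for t
      using ab that by (auto simp: abs_less_iff)
    then have "\<forall>t\<in>{a..b}. c x - e \<le> c t" "\<forall>t\<in>{a..b}. c t \<le> c x + e"
      using d(2) by (fastforce simp: abs_less_iff)+
    with dens ab(1)
    have "(c x - e) * (G b - G a) \<le> \<Phi> b - \<Phi> a" "\<Phi> b - \<Phi> a \<le> (c x + e) * (G b - G a)"
      unfolding stieltjes_density_def by blast+
    then show ?thesis by (simp add: abs_le_iff left_diff_distrib distrib_right)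
  qed
  show "\<exists>d>0. \<forall>y. norm (y - G x) < d \<longrightarrow> norm (\<psi> y - \<psi> (G x) - c x * (y - G x)) \<le> e * norm (y - G x)"
  proof (intro exI[of _ "\<kappa> * d"] conjI allI impI)
    fix y assume y: "norm (y - G x) < \<kappa> * d"
    obtain b where b: "y = G b" using \<open>surj G\<close> by (metis surjD)
    have "\<kappa> * \<bar>b - x\<bar> \<le> \<bar>G b - G x\<bar>"
      using low[of x b] low[of b x] by (cases "x \<le> b") auto
    with y have "\<kappa> * \<bar>b - x\<bar> < \<kappa> * d" by (simp add: b)
    then have bd: "\<bar>b - x\<bar> < d" using \<open>0 < \<kappa>\<close> by simp
    have mono: "G a \<le> G b" if "a \<le> b" for a b
    proof -
      have "0 \<le> \<kappa> * (b - a)" using \<open>0 < \<kappa>\<close> that by simp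
      with low[OF that] show ?thesis by linarith
    qed
    show "norm (\<psi> y - \<psi> (G x) - c x * (y - G x)) \<le> e * norm (y - G x)"
    proof (cases "x \<le> b")
      case True
      then show ?thesis using key[of x b] bd d(1) mono[OF True] by (simp add: b \<psi>)
    next
      case False
      then have "\<bar>\<Phi> x - \<Phi> b - c x * (G x - G b)\<bar> \<le> e * (G x - G b)"
        using key[of b x] bd d(1) by simp
      moreover have "\<Phi> x - \<Phi> b - c x * (G x - G b) = - (\<Phi> b - \<Phi> x - c x * (G b - G x))"
        by (simp add: algebra_simps)
      ultimately show ?thesis using mono[of b x] False by (simp add: b \<psi> abs_minus_commute)
    qed
  qed (use d \<open>0 < \<kappa>\<close> in simp)
qed (rule bounded_linear_mult_right)

theorem theorem3:
  "\<exists>f :: circle \<Rightarrow> circle.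
     homeomorphism UNIV UNIV f (inv f) \<and>
     orientation_preserving f \<and>
     minimal f \<and>
     (\<exists>p. \<not> circle_differentiable_at f p) \<and>
     circle_C1 (\<lambda>p. f p + inv f p)"
proof -
  obtain \<alpha> :: real where \<alpha>: "\<alpha> \<notin> \<rat>"
    using countable_rat uncountable_UNIV_real by (metis UNIV_eq_I)
  obtain G0 c I s where G0: "continuous_on UNIV G0" and c: "continuous_on UNIV c"
    and per: "\<And>x. G0 (x + 1) = G0 x + I"
    and low0: "\<And>x y. x \<le> y \<Longrightarrow> (y - x) / 2 \<le> G0 y - G0 x"
    and dens0: "stieltjes_density c G0 (nbr_sum \<alpha> G0)"
    and s: "\<And>n. 0 < s n" "s \<longlonglongrightarrow> 0"
    and div0: "\<not> convergent (\<lambda>n. (G0 (\<alpha> + s n) - G0 \<alpha>) / (G0 (s n) - G0 0))"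
    by (rule limit_of_stages[OF \<alpha>]) (rule that)
  have I: "1 / 2 \<le> I" using low0[of 0 1] per[of 0] by simp
  \<comment> \<open>Rescaling turns the period increment \<open>I\<close> of the limit into \<open>1\<close>.\<close>
  define G where "G x = G0 x / I" for x
  have G_diff: "G y - G x = (G0 y - G0 x) / I" for x y
    by (simp add: G_def diff_divide_distrib)
  have G1: "G (x + 1) = G x + 1" for x
    using per[of x] I by (simp add: G_def add_divide_distrib)
  have contG: "continuous_on UNIV G"
    unfolding G_def by (intro continuous_intros G0) (use I in auto)
  define \<kappa> where "\<kappa> = 1 / (2 * I)"
  have \<kappa>: "0 < \<kappa>" using I by (simp add: \<kappa>_def)
  have low: "\<kappa> * (y - x) \<le> G y - G x" if "x \<le> y" for x y
    using divide_right_mono[OF low0[OF that], of I] I by (simp add: G_diff \<kappa>_def)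
  have dens: "stieltjes_density c G (nbr_sum \<alpha> G)"
  proof -
    have nbr: "nbr_sum \<alpha> G y - nbr_sum \<alpha> G x = (nbr_sum \<alpha> G0 y - nbr_sum \<alpha> G0 x) / I" for x y
      by (simp add: nbr_sum_def G_def diff_divide_distrib add_divide_distrib)
    have "0 < I" using I by simp
    then show ?thesis
      using dens0 unfolding stieltjes_density_def nbr G_diff times_divide_eq_right
      by (simp add: divide_le_cancel)
  qed
  note conj = expanding_homeomorphism[OF \<kappa> low contG]
  have surjG: "surj G" and injG: "inj G" using conj(2) by (auto simp: bij_def)
  have GG': "G (inv G y) = y" "inv G (G x) = x" for x y
    using surjG injG by (simp_all add: surj_f_inv_f)
  have G'1: "inv G (y + 1) = inv G y + 1" for y
    using G1[of "inv G y"] GG' by metis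
  \<comment> \<open>\<open>F a\<close> is the rotation by \<open>a\<close> seen through \<open>G\<close>; \<open>F \<alpha>\<close> and \<open>F (- \<alpha>)\<close> lift \<open>f\<close> and its inverse.\<close>
  define F where "F a y = G (inv G y + a)" for a y
  have FG: "F a (G x) = G (x + a)" for a x by (simp add: F_def GG')
  have contF: "continuous_on UNIV (F a)" for a
    unfolding F_def
    by (rule continuous_on_compose2[OF contG]) (auto intro!: continuous_intros conj(3))
  have F1: "F a (y + 1) = F a y + 1" for a y
    using G1[of "inv G y + a"] unfolding F_def G'1 by (simp only: add_ac)
  obtain f where f: "circle_lift (F \<alpha>) f" using degree_one_descends[OF contF F1] by blast
  obtain g where g: "circle_lift (F (- \<alpha>)) g" using degree_one_descends[OF contF F1] by blast
  have "f \<circ> g = id"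
    by (rule circle_lift_id_unique[OF circle_lift_comp[OF f g]]) (simp add: F_def GG')
  moreover have "g \<circ> f = id"
    by (rule circle_lift_id_unique[OF circle_lift_comp[OF g f]]) (simp add: F_def GG')
  ultimately have fg: "f (g p) = p" "g (f p) = p" for p
    by (simp_all add: pointfree_idE)
  have inv_f: "inv f = g" by (rule inv_equality) (rule fg)+
  show ?thesis
  proof (intro exI[of _ f] conjI)
    show "homeomorphism UNIV UNIV f (inv f)"
      unfolding inv_f homeomorphism_def
      using fg circle_lift_continuous[OF f] circle_lift_continuous[OF g]
        surjI[of f g] surjI[of g f] by blast
    have "strict_mono (F \<alpha>)"
    proof
      fix x y :: real assume "x < y"
      then have "G (inv G x) < G (inv G y)" by (simp add: GG')
      then have "inv G x < inv G y" using conj(1) by (simp add: strict_mono_less)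
      then show "F \<alpha> x < F \<alpha> y" using conj(1) by (simp add: F_def strict_mono_less)
    qed
    with f show "orientation_preserving f" by (auto simp: orientation_preserving_def)
    have fG: "f (circle_proj (G x)) = circle_proj (G (x + \<alpha>))" for x
      using f FG[of \<alpha> x] by (metis circle_lift_def)
    show "minimal f"
      by (rule rotation_conjugate_minimal[OF \<alpha> contG surjG G1 fG])
    show "\<exists>p. \<not> circle_differentiable_at f p"
    proof (intro exI notI)
      assume "circle_differentiable_at f (circle_proj (G 0))"
      then have "F \<alpha> differentiable (at (G 0))"
        by (rule circle_differentiable_at_lift[OF f F1])
      then obtain D where "(F \<alpha> has_real_derivative D) (at (G 0))"
        by (auto simp: real_differentiable_def)
      then have D: "((\<lambda>y. (F \<alpha> y - F \<alpha> (G 0)) / (y - G 0)) \<longlongrightarrow> D) (at (G 0))"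
        by (simp add: has_field_derivative_iff)
      have "isCont G 0" using contG by (simp add: continuous_on_eq_continuous_at)
      then have "(\<lambda>n. G (s n)) \<longlonglongrightarrow> G 0" using s(2) by (rule isCont_tendsto_compose)
      moreover have "G (s n) \<noteq> G 0" for n
        using s(1)[of n] strict_mono_eq[OF conj(1), of "s n" 0] by simp
      ultimately have "filterlim (\<lambda>n. G (s n)) (at (G 0)) sequentially"
        by (simp add: filterlim_at)
      from filterlim_compose[OF D this]
      have "(\<lambda>n. (F \<alpha> (G (s n)) - F \<alpha> (G 0)) / (G (s n) - G 0)) \<longlonglongrightarrow> D" .
      moreover have "(F \<alpha> (G (s n)) - F \<alpha> (G 0)) / (G (s n) - G 0)
          = (G0 (\<alpha> + s n) - G0 \<alpha>) / (G0 (s n) - G0 0)" for n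
        unfolding FG G_diff using I by (simp add: add.commute)
      ultimately have "(\<lambda>n. (G0 (\<alpha> + s n) - G0 \<alpha>) / (G0 (s n) - G0 0)) \<longlonglongrightarrow> D"
        by (simp only:)
      with div0 show False by (blast intro: convergentI)
    qed
    show "circle_C1 (\<lambda>p. f p + inv f p)"
      unfolding circle_C1_def
    proof (intro exI conjI)
      define \<psi> where "\<psi> y = F \<alpha> y + F (- \<alpha>) y" for y
      show "circle_lift \<psi> (\<lambda>p. f p + inv f p)"
        unfolding inv_f circle_lift_def \<psi>_def
        using f g by (auto simp: circle_lift_def circle_proj_add intro!: continuous_intros contF)
      have \<psi>G: "\<psi> (G x) = nbr_sum \<alpha> G x" for x
        by (simp add: \<psi>_def FG nbr_sum_def)
      have "(\<psi> has_vector_derivative c (inv G y)) (at y)" for y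
        using stieltjes_chain_derivative[OF \<kappa> low surjG c dens \<psi>G, of "inv G y"]
        by (simp add: GG' has_real_derivative_iff_has_vector_derivative)
      moreover have "continuous_on UNIV (\<lambda>y. c (inv G y))"
        by (rule continuous_on_compose2[OF c conj(3)]) auto
      ultimately show "\<psi> C1_differentiable_on UNIV"
        unfolding C1_differentiable_on_def by (intro exI[of _ "\<lambda>y. c (inv G y)"]) blast
    qed
  qed
qed

end
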